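(* For $i=1,2$ let $G_{i}$ be an $r_{i}$-regular graph of order $p_{i}$ with adjacency spectrum $\{r_{i},\lambda_{i_{2}},\ldots,\lambda_{i_{p_{i}}}\}$. Then the distance signless Laplacian spectrum of the subdivision-vertex join $G_{1}\dot{\vee}G_{2}$ consists of: (1) for $j=2,\ldots,p_1$, writing $\lambda=\lambda_{1_j}$: $-\lambda+\frac{5p_{1}}{2}+\frac{3p_{2}}{2}+\frac{7p_{1}r_{1}}{4}+\frac{5p_{2}r_{2}}{4}-4r_{1}-4\pm\frac{1}{2}\sqrt{\Delta_{1,j}}$, where $\Delta_{1,j}=4\lambda^2-2\lambda p_{1}r_{1}-4\lambda p_{1}-2\lambda p_{2}r_{2}-4\lambda p_{2}+16\lambda r_{1}+16\lambda+\frac{1}{4}p_{1}^2r_{1}^2+p_{1}^2r_{1}+p_{1}^2+\frac{1}{2}p_{1}p_{2}r_{1}r_{2}+p_{1}p_{2}r_{1}+p_{1}p_{2}r_{2}+2p_{1}p_{2}-4p_{1}r_{1}^2-8p_{1}r_{1}+\frac{1}{4}p_{2}^2r_{2}^2+p_{2}^2r_{2}+p_{2}^2-4p_{2}r_{1}r_{2}-8p_{2}r_{1}+16r_{1}^2+16r_{1}$; (2) for $j=2,\ldots,p_2$, writing $\lambda=\lambda_{2_j}$: $-\lambda+\frac{3p_{1}}{2}+\frac{5p_{2}}{2}+\frac{5p_{1}r_{1}}{4}+\frac{7p_{2}r_{2}}{4}-4r_{2}-4\pm\frac{1}{2}\sqrt{\Delta_{2,j}}$, where $\Delta_{2,j}=4\lambda^2-2\lambda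 p_{1}r_{1}-4\lambda p_{1}-2\lambda p_{2}r_{2}-4\lambda p_{2}+16\lambda r_{2}+16\lambda+\frac{1}{4}p_{1}^2r_{1}^2+p_{1}^2r_{1}+p_{1}^2+\frac{1}{2}p_{1}p_{2}r_{1}r_{2}+p_{1}p_{2}r_{1}+p_{1}p_{2}r_{2}+2p_{1}p_{2}-4p_{1}r_{1}r_{2}-8p_{1}r_{2}+\frac{1}{4}p_{2}^2r_{2}^2+p_{2}^2r_{2}+p_{2}^2-4p_{2}r_{2}^{2}-8p_{2}r_{2}+16r_{2}^2+16r_{2}$; (3) $3p_{1}+2p_{1}r_{1}+2p_{2}+\frac{3}{2}p_{2}r_{2}-4r_{1}-4$ with multiplicity $\frac{1}{2}p_{1}r_{1}-p_{1}$; (4) $2p_{1}+\frac{3}{2}p_{1}r_{1}+3p_{2}+2p_{2}r_{2}-4r_{2}-4$ with multiplicity $\frac{1}{2}p_{2}r_{2}-p_{2}$; (5) the four eigenvalues of the matrix $$\begin{bmatrix} 4p_{1}+\frac{3}{2}p_{1}r_{1}+p_{2}+p_{2}r_{2}-2r_{1}-4 & \frac{3}{2}p_{1}r_{1}-2r_{1} & p_{2} & p_{2}r_{2}\\ 3p_{1}-4 & 3p_{1}+4p_{1}r_{1}+2p_{2}+\frac{3}{2}p_{2}r_{2}-8r_{1}-4 & 2p_{2} & \frac{3}{2}p_{2}r_{2}\\ p_{1} & p_{1}r_{1} & p_{1}+p_{1}r_{1}+4p_{2}+\frac{3}{2}p_{2}r_{2}-2r_{2}-4 & \frac{3}{2}p_{2}r_{2}-2r_{2}\\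 2p_{1} & \frac{3}{2}p_{1}r_{1} & 3p_{2}-4 & 2p_{1}+\frac{3}{2}p_{1}r_{1}+3p_{2}+4p_{2}r_{2}-8r_{2}-4\end{bmatrix}.$$
   Context: The subdivision graph $S(G)$ is obtained from $G$ by inserting a new vertex into every edge; $I(G)$ denotes the set of these new vertices, and $V(G)$ the original vertices. The subdivision-vertex join $G_1\dot{\vee}G_2$ is obtained from $S(G_1)$ and $S(G_2)$ by joining each vertex of $V(G_1)$ with every vertex of $V(G_2)$. For a connected graph, $\mathcal{D}$ is its distance matrix, $Tr$ the diagonal matrix of vertex transmissions ($Tr(u)=\sum_v d(u,v)$), and the distance signless Laplacian matrix is $\mathcal{Q}=Tr+\mathcal{D}$. *)

theory Defs
  imports
    "Graph_Theory.Pair_Digraph"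
    "Graph_Theory.Shortest_Path"
    "Jordan_Normal_Form.Char_Poly"
    "HOL-Computational_Algebra.Fundamental_Theorem_Algebra"
begin

text \<open>
  A finite simple graph is a pair digraph satisfying \<open>pair_graph\<close> (finite, loopless,
  symmetric): an undirected edge \<open>{u, v}\<close> is represented by the two arcs \<open>(u, v)\<close>, \<open>(v, u)\<close>.
  In particular the out-degree is the degree.
\<close>

definition regular_graph :: "'a pair_pre_digraph \<Rightarrow> nat \<Rightarrow> bool" where
  "regular_graph G r \<longleftrightarrow> pair_graph G \<and> (\<forall>v\<in>pverts G. out_degree (with_proj G) v = r)"

definition uedges :: "'a pair_pre_digraph \<Rightarrow> 'a set set" where
  "uedges G = (\<lambda>(u, v). {u, v}) ` parcs G"

text \<open>
  In the subdivision graph \<open>Inl v\<close> is the original vertex \<open>v\<close>, and \<open>Inr e\<close> is the new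
  vertex inserted into the undirected edge \<open>e\<close>.
\<close>

definition subdivision_graph :: "'a pair_pre_digraph \<Rightarrow> ('a + 'a set) pair_pre_digraph" where
  "subdivision_graph G =
     \<lparr> pverts = pverts G <+> uedges G,
       parcs = {(Inl v, Inr e) | v e. e \<in> uedges G \<and> v \<in> e}
             \<union> {(Inr e, Inl v) | v e. e \<in> uedges G \<and> v \<in> e} \<rparr>"

definition subdivision_vertex_join ::
  "'a pair_pre_digraph \<Rightarrow> 'b pair_pre_digraph \<Rightarrow> (('a + 'a set) + ('b + 'b set)) pair_pre_digraph"
where
  "subdivision_vertex_join G1 G2 =
     \<lparr> pverts = pverts (subdivision_graph G1) <+> pverts (subdivision_graph G2),
       parcs = map_prod Inl Inl ` parcs (subdivision_graph G1)
             \<union> map_prod Inr Inr ` parcs (subdivision_graph G2)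
             \<union> {(Inl (Inl u), Inr (Inl v)) | u v. u \<in> pverts G1 \<and> v \<in> pverts G2}
             \<union> {(Inr (Inl v), Inl (Inl u)) | u v. u \<in> pverts G1 \<and> v \<in> pverts G2} \<rparr>"

lemma uedges_subset: "pair_graph G \<Longrightarrow> e \<in> uedges G \<Longrightarrow> e \<subseteq> pverts G"
proof -
  assume "pair_graph G" and e: "e \<in> uedges G"
  then interpret pair_graph G by simp
  show ?thesis using e by (auto simp: uedges_def dest: in_arcsD1 in_arcsD2)
qed

lemma finite_uedges: "pair_graph G \<Longrightarrow> finite (uedges G)"
  by (simp add: uedges_def pair_graph_def pair_digraph_def pair_fin_digraph_def
      pair_fin_digraph_axioms_def)

lemma pair_graphI:
  assumes "finite (pverts G)" "parcs G \<subseteq> pverts G \<times> pverts G" "irrefl (parcs G)" "sym (parcs G)"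
  shows "pair_graph G"
proof -
  have "finite (parcs G)"
    using assms(1,2) by (meson finite_SigmaI finite_subset)
  then show ?thesis
    using assms by unfold_locales (auto simp: irrefl_def symmetric_def)
qed

lemma pair_graph_subdivision_graph:
  assumes "pair_graph G"
  shows "pair_graph (subdivision_graph G)"
proof (rule pair_graphI)
  interpret pair_graph G by (rule assms)
  show "finite (pverts (subdivision_graph G))"
    using pair_finite_verts finite_uedges[OF assms] by (simp add: subdivision_graph_def)
  show "parcs (subdivision_graph G) \<subseteq> pverts (subdivision_graph G) \<times> pverts (subdivision_graph G)"
    using uedges_subset[OF assms] by (auto simp: subdivision_graph_def)
qed (auto simp: subdivision_graph_def irrefl_def sym_def)

lemma pair_graph_subdivision_vertex_join:
  assumes "pair_graph G1" "pair_graph G2"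
  shows "pair_graph (subdivision_vertex_join G1 G2)"
proof (rule pair_graphI)
  let ?J = "subdivision_vertex_join G1 G2"
  interpret S1: pair_graph "subdivision_graph G1" using assms by (intro pair_graph_subdivision_graph)
  interpret S2: pair_graph "subdivision_graph G2" using assms by (intro pair_graph_subdivision_graph)
  have sub: "Inl u \<in> pverts (subdivision_graph G) \<longleftrightarrow> u \<in> pverts G"
    for u and G :: "'c pair_pre_digraph" by (auto simp: subdivision_graph_def)
  show "finite (pverts ?J)"
    using S1.pair_finite_verts S2.pair_finite_verts by (simp add: subdivision_vertex_join_def)
  show "parcs ?J \<subseteq> pverts ?J \<times> pverts ?J"
    by (auto simp: subdivision_vertex_join_def sub
        dest: S1.in_arcsD1 S1.in_arcsD2 S2.in_arcsD1 S2.in_arcsD2)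
  show "irrefl (parcs ?J)"
    using S1.pair_no_loops S2.pair_no_loops
    by (fastforce simp: subdivision_vertex_join_def irrefl_def)
  have "sym (parcs (subdivision_graph G1))" "sym (parcs (subdivision_graph G2))"
    using S1.pair_sym_arcs S2.pair_sym_arcs by (simp_all add: symmetric_def)
  then show "sym (parcs ?J)"
    by (auto simp: subdivision_vertex_join_def sym_def)
qed

text \<open>
  Distance is the library's weighted distance with unit weights. It takes values in \<open>ereal\<close>;
  the conversion to \<open>real\<close> is harmless as long as the graph is connected, which the
  subdivision-vertex join of two nonempty graphs always is.
\<close>

definition graph_dist :: "'a pair_pre_digraph \<Rightarrow> 'a \<Rightarrow> 'a \<Rightarrow> real" where
  "graph_dist G u v = real_of_ereal (wf_digraph.\<mu> (with_proj G) (\<lambda>_. 1) u v)"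

definition transmission :: "'a pair_pre_digraph \<Rightarrow> 'a \<Rightarrow> real" where
  "transmission G u = (\<Sum>v\<in>pverts G. graph_dist G u v)"

text \<open>
  Matrices are taken with respect to an enumeration \<open>vs\<close> of the vertex set.
\<close>

definition adjacency_matrix :: "'a pair_pre_digraph \<Rightarrow> 'a list \<Rightarrow> real mat" where
  "adjacency_matrix G vs =
     mat (length vs) (length vs) (\<lambda>(i, j). of_bool ((vs ! i, vs ! j) \<in> parcs G))"

definition distance_matrix :: "'a pair_pre_digraph \<Rightarrow> 'a list \<Rightarrow> real mat" where
  "distance_matrix G vs =
     mat (length vs) (length vs) (\<lambda>(i, j). graph_dist G (vs ! i) (vs ! j))"

definition transmission_matrix :: "'a pair_pre_digraph \<Rightarrow> 'a list \<Rightarrow> real mat" where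
  "transmission_matrix G vs = mat_diag (length vs) (\<lambda>i. transmission G (vs ! i))"

definition distance_signless_laplacian :: "'a pair_pre_digraph \<Rightarrow> 'a list \<Rightarrow> real mat" where
  "distance_signless_laplacian G vs = transmission_matrix G vs + distance_matrix G vs"

text \<open>
  Eigenvalues are counted with algebraic multiplicity, over the complex numbers, so that an
  \<open>n \<times> n\<close> matrix has exactly \<open>n\<close> of them.
\<close>

definition eigenvalue_mset :: "real mat \<Rightarrow> complex multiset" where
  "eigenvalue_mset A = proots (char_poly (map_mat complex_of_real A))"

definition Delta1 :: "real \<Rightarrow> real \<Rightarrow> real \<Rightarrow> real \<Rightarrow> real \<Rightarrow> real" where
  "Delta1 p1 r1 p2 r2 l =
     4 * l^2 - 2 * l * p1 * r1 - 4 * l * p1 - 2 * l * p2 * r2 - 4 * l * p2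
     + 16 * l * r1 + 16 * l
     + 1/4 * p1^2 * r1^2 + p1^2 * r1 + p1^2
     + 1/2 * p1 * p2 * r1 * r2 + p1 * p2 * r1 + p1 * p2 * r2 + 2 * p1 * p2
     - 4 * p1 * r1^2 - 8 * p1 * r1
     + 1/4 * p2^2 * r2^2 + p2^2 * r2 + p2^2
     - 4 * p2 * r1 * r2 - 8 * p2 * r1 + 16 * r1^2 + 16 * r1"

definition Delta2 :: "real \<Rightarrow> real \<Rightarrow> real \<Rightarrow> real \<Rightarrow> real \<Rightarrow> real" where
  "Delta2 p1 r1 p2 r2 l =
     4 * l^2 - 2 * l * p1 * r1 - 4 * l * p1 - 2 * l * p2 * r2 - 4 * l * p2
     + 16 * l * r2 + 16 * l
     + 1/4 * p1^2 * r1^2 + p1^2 * r1 + p1^2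
     + 1/2 * p1 * p2 * r1 * r2 + p1 * p2 * r1 + p1 * p2 * r2 + 2 * p1 * p2
     - 4 * p1 * r1 * r2 - 8 * p1 * r2
     + 1/4 * p2^2 * r2^2 + p2^2 * r2 + p2^2
     - 4 * p2 * r2^2 - 8 * p2 * r2 + 16 * r2^2 + 16 * r2"

definition quotient_matrix :: "real \<Rightarrow> real \<Rightarrow> real \<Rightarrow> real \<Rightarrow> real mat" where
  "quotient_matrix p1 r1 p2 r2 = mat_of_rows_list 4
     [[4*p1 + 3/2*p1*r1 + p2 + p2*r2 - 2*r1 - 4,
       3/2*p1*r1 - 2*r1,
       p2,
       p2*r2],
      [3*p1 - 4,
       3*p1 + 4*p1*r1 + 2*p2 + 3/2*p2*r2 - 8*r1 - 4,
       2*p2,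
       3/2*p2*r2],
      [p1,
       p1*r1,
       p1 + p1*r1 + 4*p2 + 3/2*p2*r2 - 2*r2 - 4,
       3/2*p2*r2 - 2*r2],
      [2*p1,
       3/2*p1*r1,
       3*p2 - 4,
       2*p1 + 3/2*p1*r1 + 3*p2 + 4*p2*r2 - 8*r2 - 4]]"

text \<open>
  For \<open>r = 0\<close> and \<open>r = 1\<close> the multiplicity \<open>p * r / 2 - p\<close> is negative, meaning that
  so many copies are to be removed from the other listed eigenvalues. A value \<open>c\<close> of
  multiplicity \<open>m - p\<close> (with \<open>m = p * r div 2\<close> the number of edges) is therefore written with
  truncated subtraction as \<open>replicate_mset (m - p) c\<close> on the side of the list and
  \<open>replicate_mset (p - m) c\<close> on the side of the spectrum, at most one of which is nonempty;
  the latter is empty whenever \<open>r \<ge> 2\<close>.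
\<close>

end

theory Submission
  imports Defs
begin

text \<open>
  Write \<open>ends x\<close> for \<open>{v}\<close> or for the edge \<open>e\<close>, and \<open>level x\<close> for 0 or 1, according to whether
  the vertex \<open>x\<close> of a subdivision graph is an original vertex \<open>v\<close> or the midpoint of \<open>e\<close>. In
  the join, two vertices of the same side have distance
  \<open>2 + level x + level y - 2 |ends x \<inter> ends y|\<close>, and two vertices of different sides have
  distance \<open>1 + level x + level y\<close>. Hence \<open>z 1 - Q = N - U S U\<^sup>T\<close>, where \<open>U\<close> is the indicator
  matrix of the four cells (side, level) and \<open>N\<close> is block diagonal, with diagonal entries and
  entries \<open>2 |ends x \<inter> ends y|\<close>. The cells are equitable for \<open>N\<close>, i.e. \<open>N U = U K\<close> for a
  \<open>4 \<times> 4\<close> matrix \<open>K\<close>, so that \<open>det (z 1 - Q) det K = det N det (K - S U\<^sup>T U)\<close>, the last factor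
  being the characteristic polynomial of the quotient matrix. Each block of \<open>N\<close> is
  \<open>[[a 1, 2 B], [2 B\<^sup>T, b 1 + 2 B\<^sup>T B]]\<close> with the incidence matrix \<open>B\<close>; as \<open>B B\<^sup>T = A + r 1\<close>,
  its determinant is a power of \<open>b\<close> times \<open>\<Prod>\<^sub>\<lambda> (a b + 2 (a - 2) (\<lambda> + r))\<close> over the adjacency
  eigenvalues, and the factors at \<open>\<lambda> = r\<close> are exactly \<open>det K\<close>. The other factors split over the
  reals because \<open>\<lambda> + r \<ge> 0\<close>.
\<close>

section \<open>Determinants of matrices indexed by lists\<close>

text \<open>Entries are given as a function of the list elements instead of positions, so that
  products become sums over sets and a concatenated enumeration gives a block matrix.\<close>

definition idx_mat :: "'a list \<Rightarrow> 'b list \<Rightarrow> ('a \<Rightarrow> 'b \<Rightarrow> 'c) \<Rightarrow> 'c mat" where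
  "idx_mat xs ys f = mat (length xs) (length ys) (\<lambda>(i, j). f (xs ! i) (ys ! j))"

lemma idx_mat_carrier [simp]: "idx_mat xs ys f \<in> carrier_mat (length xs) (length ys)"
  by (simp add: idx_mat_def)

lemma idx_mat_dims [simp]:
  "dim_row (idx_mat xs ys f) = length xs" "dim_col (idx_mat xs ys f) = length ys"
  by (simp_all add: idx_mat_def)

lemma idx_mat_index [simp]:
  "i < length xs \<Longrightarrow> j < length ys \<Longrightarrow> idx_mat xs ys f $$ (i, j) = f (xs ! i) (ys ! j)"
  by (simp add: idx_mat_def)

lemma idx_mat_cong:
  assumes "\<And>x y. x \<in> set xs \<Longrightarrow> y \<in> set ys \<Longrightarrow> f x y = g x y"
  shows "idx_mat xs ys f = idx_mat xs ys g"
  by (rule eq_matI) (auto intro: assms)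

lemma idx_mat_map: "idx_mat (map h xs) (map k ys) f = idx_mat xs ys (\<lambda>x y. f (h x) (k y))"
  by (rule eq_matI) auto

lemma idx_mat_mult:
  assumes "distinct ys"
  shows "idx_mat xs ys f * idx_mat ys zs g
    = (idx_mat xs zs (\<lambda>x z. \<Sum>y\<in>set ys. f x y * g y z) :: 'c :: comm_semiring_0 mat)"
proof (rule eq_matI)
  fix i j assume "i < dim_row (idx_mat xs zs (\<lambda>x z. \<Sum>y\<in>set ys. f x y * g y z))"
    "j < dim_col (idx_mat xs zs (\<lambda>x z. \<Sum>y\<in>set ys. f x y * g y z))"
  then have ij: "i < length xs" "j < length zs" by simp_all
  have "(idx_mat xs ys f * idx_mat ys zs g) $$ (i, j)
    = (\<Sum>k<length ys. f (xs ! i) (ys ! k) * g (ys ! k) (zs ! j))"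
    using ij by (simp add: scalar_prod_def lessThan_atLeast0)
  also have "\<dots> = (\<Sum>y\<in>set ys. f (xs ! i) y * g y (zs ! j))"
    by (rule sum.reindex_bij_betw[OF bij_betw_nth[OF assms refl refl]])
  finally show "(idx_mat xs ys f * idx_mat ys zs g) $$ (i, j)
    = idx_mat xs zs (\<lambda>x z. \<Sum>y\<in>set ys. f x y * g y z) $$ (i, j)"
    using ij by simp
qed simp_all

lemma idx_mat_one: "distinct xs \<Longrightarrow> idx_mat xs xs (\<lambda>x y. of_bool (x = y)) = 1\<^sub>m (length xs)"
  by (rule eq_matI) (auto simp: nth_eq_iff_index_eq)

lemma idx_mat_append:
  "idx_mat (xs @ xs') (ys @ ys') f
    = four_block_mat (idx_mat xs ys f) (idx_mat xs ys' f) (idx_mat xs' ys f) (idx_mat xs' ys' f)"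
  by (rule eq_matI) (auto simp: nth_append)

text \<open>Conjugation by the permutation matrix between the two enumerations. It lets an arbitrary
  enumeration of the join be replaced by one that lists the first side before the second.\<close>

lemma det_idx_mat_reorder:
  fixes f :: "'a \<Rightarrow> 'a \<Rightarrow> 'c :: comm_ring_1"
  assumes "distinct xs" "distinct ys" "set xs = set ys"
  shows "det (idx_mat xs xs f) = det (idx_mat ys ys f)"
proof (rule det_similar, rule similar_matI)
  let ?I = "\<lambda>x y. of_bool (x = y) :: 'c"
  have len: "length xs = length ys"
    using assms by (metis distinct_card)
  show "{idx_mat xs xs f, idx_mat ys ys f, idx_mat xs ys ?I, idx_mat ys xs ?I}
      \<subseteq> carrier_mat (length xs) (length xs)"
    using idx_mat_carrier[of xs xs f] idx_mat_carrier[of ys ys f]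
      idx_mat_carrier[of xs ys ?I] idx_mat_carrier[of ys xs ?I]
    by (auto simp: len simp del: idx_mat_carrier)
  have dlt: "A \<inter> {x} = {x}" "A \<inter> {y. y = x} = {x}" if "x \<in> A" for A and x :: 'a
    using that by auto
  have "idx_mat xs ys ?I * idx_mat ys xs ?I = idx_mat xs xs ?I"
    unfolding idx_mat_mult[OF assms(2)] by (rule idx_mat_cong) (simp add: assms dlt)
  then show "idx_mat xs ys ?I * idx_mat ys xs ?I = 1\<^sub>m (length xs)"
    by (simp add: idx_mat_one assms)
  have "idx_mat ys xs ?I * idx_mat xs ys ?I = idx_mat ys ys ?I"
    unfolding idx_mat_mult[OF assms(1)] by (rule idx_mat_cong) (simp add: assms dlt)
  then show "idx_mat ys xs ?I * idx_mat xs ys ?I = 1\<^sub>m (length xs)"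
    by (simp add: idx_mat_one assms len)
  show "idx_mat xs xs f = idx_mat xs ys ?I * idx_mat ys ys f * idx_mat ys xs ?I"
    unfolding idx_mat_mult[OF assms(2)] by (rule idx_mat_cong) (simp add: assms dlt)
qed

text \<open>A Schur complement: multiplying on the right by the unimodular \<open>?L\<close> clears
  the lower left block \<open>T\<close>.\<close>

lemma det_four_block_mat_one:
  fixes N :: "'c :: idom mat"
  assumes "N \<in> carrier_mat n n" "U \<in> carrier_mat n k" "T \<in> carrier_mat k n"
  shows "det (four_block_mat N U T (1\<^sub>m k)) = det (N - U * T)"
proof -
  let ?L = "four_block_mat (1\<^sub>m n) (0\<^sub>m n k) (- T) (1\<^sub>m k)"
  have c: "- T \<in> carrier_mat k n" "N - U * T \<in> carrier_mat n n" using assms by auto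
  have "four_block_mat N U T (1\<^sub>m k) * ?L
      = four_block_mat (N * 1\<^sub>m n + U * - T) (N * 0\<^sub>m n k + U * 1\<^sub>m k)
          (T * 1\<^sub>m n + 1\<^sub>m k * - T) (T * 0\<^sub>m n k + 1\<^sub>m k * 1\<^sub>m k)"
    by (rule mult_four_block_mat[of _ n n _ k _ k _ _ n _ k]) (use assms c in simp_all)
  also have "\<dots> = four_block_mat (N - U * T) U (0\<^sub>m k n) (1\<^sub>m k)"
    using assms c by (intro cong_four_block_mat) (auto intro!: eq_matI simp: scalar_prod_def sum_negf)
  finally have "det (four_block_mat N U T (1\<^sub>m k)) * det ?L
      = det (four_block_mat (N - U * T) U (0\<^sub>m k n) (1\<^sub>m k))"
    using assms by (metis carrier_matI det_mult four_block_carrier_mat one_carrier_mat)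
  moreover have "det ?L = 1"
    using c by (simp add: det_four_block_mat_upper_right_zero[of _ n _ k])
  ultimately show ?thesis
    using assms c by (simp add: det_four_block_mat_lower_left_zero[of _ n _ k])
qed

text \<open>
  With \<open>N U = U K\<close> the identity is read off the product of
  \<open>[[N, U], [T, 1]]\<close> and \<open>[[1, -U], [0, K]]\<close>; no inverse of \<open>N\<close> or \<open>K\<close> is needed.
\<close>
lemma det_quotient:
  fixes N :: "'c :: idom mat"
  assumes N: "N \<in> carrier_mat n n" and U: "U \<in> carrier_mat n k" and T: "T \<in> carrier_mat k n"
    and K: "K \<in> carrier_mat k k" and NU: "N * U = U * K"
  shows "det (N - U * T) * det K = det N * det (K - T * U)"
proof -
  let ?L = "four_block_mat (1\<^sub>m n) (- U) (0\<^sub>m k n) K"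
  have c: "- U \<in> carrier_mat n k" "K - T * U \<in> carrier_mat k k"
    "four_block_mat N U T (1\<^sub>m k) \<in> carrier_mat (n + k) (n + k)" "?L \<in> carrier_mat (n + k) (n + k)"
    using assms by auto
  have "four_block_mat N U T (1\<^sub>m k) * ?L
      = four_block_mat (N * 1\<^sub>m n + U * 0\<^sub>m k n) (N * - U + U * K)
          (T * 1\<^sub>m n + 1\<^sub>m k * 0\<^sub>m k n) (T * - U + 1\<^sub>m k * K)"
    by (rule mult_four_block_mat[of _ n n _ k _ k _ _ n _ k]) (use assms(1-4) c in simp_all)
  \<comment> \<open>The hypothesis \<open>NU\<close> makes the upper right block vanish.\<close>
  also have "\<dots> = four_block_mat N (0\<^sub>m n k) T (K - T * U)"
    using assms c unfolding NU[symmetric]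
    by (intro cong_four_block_mat) (auto intro!: eq_matI simp: scalar_prod_def sum_negf)
  finally have "det (four_block_mat N U T (1\<^sub>m k)) * det ?L
      = det (four_block_mat N (0\<^sub>m n k) T (K - T * U))"
    using c by (metis det_mult)
  then show ?thesis
    using assms c by (simp add: det_four_block_mat_one det_four_block_mat_upper_right_zero[of _ n _ k]
        det_four_block_mat_lower_left_zero[of _ n _ k])
qed

text \<open>With the cell indicator matrix \<open>U\<close> and \<open>T\<close> equal to
  \<open>S\<close> times its transpose, \<open>U * T\<close> is constant on pairs of cells,
  \<open>T * U\<close> carries the cell sizes, and the row sum hypothesis says that
  \<open>N * U\<close> is \<open>U\<close> times \<open>K\<close>. Cells may be empty, as happens
  for graphs without edges.\<close>

lemma det_equitable:
  fixes N :: "'a \<Rightarrow> 'a \<Rightarrow> 'c :: idom"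
  assumes ws: "distinct ws" and cell: "\<And>x. x \<in> set ws \<Longrightarrow> cell x < k"
    and K: "\<And>x j. x \<in> set ws \<Longrightarrow> j < k \<Longrightarrow> (\<Sum>y | y \<in> set ws \<and> cell y = j. N x y) = K (cell x) j"
  shows "det (idx_mat ws ws (\<lambda>x y. N x y - S (cell x) (cell y))) * det (idx_mat [0..<k] [0..<k] K)
    = det (idx_mat ws ws N)
      * det (idx_mat [0..<k] [0..<k] (\<lambda>i j. K i j - S i j * of_nat (card {y \<in> set ws. cell y = j})))"
proof -
  let ?is = "[0..<k]"
  define U where "U = idx_mat ws ?is (\<lambda>x j. of_bool (cell x = j) :: 'c)"
  define T where "T = idx_mat ?is ws (\<lambda>i y. S i (cell y))"
  have sel: "(\<Sum>y\<in>set ws. h y * of_bool (cell y = j)) = (\<Sum>y | y \<in> set ws \<and> cell y = j. h y)"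
    for h :: "'a \<Rightarrow> 'c" and j
    by (simp add: of_bool_def if_distrib[of "\<lambda>c. _ * c"] sum.If_cases Int_def cong: if_cong)
  have pick: "{0..<k} \<inter> {cell x} = {cell x}" if "x \<in> set ws" for x
    using cell[OF that] by auto
  have NU: "idx_mat ws ws N * U = U * idx_mat ?is ?is K"
    unfolding U_def idx_mat_mult[OF ws] idx_mat_mult[OF distinct_upt]
    by (rule idx_mat_cong) (simp add: sel pick K)
  have UT: "U * T = idx_mat ws ws (\<lambda>x y. S (cell x) (cell y))"
    unfolding U_def T_def idx_mat_mult[OF distinct_upt] by (rule idx_mat_cong) (simp add: pick)
  have "T * U = idx_mat ?is ?is (\<lambda>i j. \<Sum>y | y \<in> set ws \<and> cell y = j. S i (cell y))"
    unfolding U_def T_def idx_mat_mult[OF ws] by (rule idx_mat_cong) (simp add: sel)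
  also have "\<dots> = idx_mat ?is ?is (\<lambda>i j. S i j * of_nat (card {y \<in> set ws. cell y = j}))"
    by (rule idx_mat_cong) (simp add: mult.commute)
  finally have TU: "T * U = \<dots>" .
  have diff: "idx_mat xs ys f - idx_mat xs ys g = idx_mat xs ys (\<lambda>x y. f x y - g x y)"
    for xs ys and f g :: "'d \<Rightarrow> 'e \<Rightarrow> 'c"
    by (rule eq_matI) auto
  have c: "U \<in> carrier_mat (length ws) (length ?is)" "T \<in> carrier_mat (length ?is) (length ws)"
    by (simp_all only: U_def T_def idx_mat_carrier)
  show ?thesis
    using det_quotient[OF idx_mat_carrier c idx_mat_carrier NU] by (simp add: UT TU diff)
qed

text \<open>
  Eliminates the second block column of \<open>[[a 1, 2 B], [2 B\<^sup>T, b 1 + 2 B\<^sup>T B]]\<close>: subtracting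
  \<open>B\<^sup>T\<close> times the first block row turns the lower row into \<open>[(2 - a) B\<^sup>T, b 1]\<close>.
\<close>
lemma det_incidence_block:
  fixes B :: "'c :: idom mat"
  assumes B: "B \<in> carrier_mat p m"
  shows "det (four_block_mat (a \<cdot>\<^sub>m 1\<^sub>m p) (2 \<cdot>\<^sub>m B) (2 \<cdot>\<^sub>m B\<^sup>T) (b \<cdot>\<^sub>m 1\<^sub>m m + 2 \<cdot>\<^sub>m (B\<^sup>T * B))) * b ^ p
    = b ^ m * det ((a * b) \<cdot>\<^sub>m 1\<^sub>m p + (2 * (a - 2)) \<cdot>\<^sub>m (B * B\<^sup>T))"
proof -
  let ?M = "four_block_mat (a \<cdot>\<^sub>m 1\<^sub>m p) (2 \<cdot>\<^sub>m B) (2 \<cdot>\<^sub>m B\<^sup>T) (b \<cdot>\<^sub>m 1\<^sub>m m + 2 \<cdot>\<^sub>m (B\<^sup>T * B))"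
  let ?L = "four_block_mat (1\<^sub>m p) (0\<^sub>m p m) (- B\<^sup>T) (1\<^sub>m m)"
  \<comment> \<open>\<open>?R\<close> scales the first block column by \<open>b\<close> and adds to
    it the second one times \<open>(a - 2) \<cdot>\<^sub>m B\<^sup>T\<close>, which cancels the
    lower left block. Its determinant is the extra factor \<open>b ^ p\<close>.\<close>
  let ?R = "four_block_mat (b \<cdot>\<^sub>m 1\<^sub>m p) (0\<^sub>m p m) ((a - 2) \<cdot>\<^sub>m B\<^sup>T) (1\<^sub>m m)"
  let ?E = "(a * b) \<cdot>\<^sub>m 1\<^sub>m p + (2 * (a - 2)) \<cdot>\<^sub>m (B * B\<^sup>T)"
  have c: "- B\<^sup>T \<in> carrier_mat m p" "?M \<in> carrier_mat (p + m) (p + m)" "?L \<in> carrier_mat (p + m) (p + m)"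
    "?R \<in> carrier_mat (p + m) (p + m)" "?E \<in> carrier_mat p p" "B\<^sup>T \<in> carrier_mat m p"
    using B by auto
  have "?L * ?M = four_block_mat
      (1\<^sub>m p * (a \<cdot>\<^sub>m 1\<^sub>m p) + 0\<^sub>m p m * (2 \<cdot>\<^sub>m B\<^sup>T))
      (1\<^sub>m p * (2 \<cdot>\<^sub>m B) + 0\<^sub>m p m * (b \<cdot>\<^sub>m 1\<^sub>m m + 2 \<cdot>\<^sub>m (B\<^sup>T * B)))
      (- B\<^sup>T * (a \<cdot>\<^sub>m 1\<^sub>m p) + 1\<^sub>m m * (2 \<cdot>\<^sub>m B\<^sup>T))
      (- B\<^sup>T * (2 \<cdot>\<^sub>m B) + 1\<^sub>m m * (b \<cdot>\<^sub>m 1\<^sub>m m + 2 \<cdot>\<^sub>m (B\<^sup>T * B)))"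
    by (rule mult_four_block_mat) (use B c in auto)
  also have "\<dots> = four_block_mat (a \<cdot>\<^sub>m 1\<^sub>m p) (2 \<cdot>\<^sub>m B) ((2 - a) \<cdot>\<^sub>m B\<^sup>T) (b \<cdot>\<^sub>m 1\<^sub>m m)"
  proof (intro cong_four_block_mat)
    show "- B\<^sup>T * (a \<cdot>\<^sub>m 1\<^sub>m p) + 1\<^sub>m m * (2 \<cdot>\<^sub>m B\<^sup>T) = (2 - a) \<cdot>\<^sub>m B\<^sup>T"
      using B by (subst mult_smult_distrib[of _ m p]) (auto intro!: eq_matI simp: algebra_simps)
    show "- B\<^sup>T * (2 \<cdot>\<^sub>m B) + 1\<^sub>m m * (b \<cdot>\<^sub>m 1\<^sub>m m + 2 \<cdot>\<^sub>m (B\<^sup>T * B)) = b \<cdot>\<^sub>m 1\<^sub>m m"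
      using B c by (subst mult_smult_distrib[of _ m p]) (auto intro!: eq_matI simp: algebra_simps)
  qed (use B in auto)
  finally have LM: "?L * ?M = \<dots>" .
  have "(?L * ?M) * ?R = four_block_mat
      ((a \<cdot>\<^sub>m 1\<^sub>m p) * (b \<cdot>\<^sub>m 1\<^sub>m p) + (2 \<cdot>\<^sub>m B) * ((a - 2) \<cdot>\<^sub>m B\<^sup>T))
      ((a \<cdot>\<^sub>m 1\<^sub>m p) * 0\<^sub>m p m + (2 \<cdot>\<^sub>m B) * 1\<^sub>m m)
      ((2 - a) \<cdot>\<^sub>m B\<^sup>T * (b \<cdot>\<^sub>m 1\<^sub>m p) + (b \<cdot>\<^sub>m 1\<^sub>m m) * ((a - 2) \<cdot>\<^sub>m B\<^sup>T))
      ((2 - a) \<cdot>\<^sub>m B\<^sup>T * 0\<^sub>m p m + (b \<cdot>\<^sub>m 1\<^sub>m m) * 1\<^sub>m m)"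
    unfolding LM by (rule mult_four_block_mat) (use B c in auto)
  also have "\<dots> = four_block_mat ?E (2 \<cdot>\<^sub>m B) (0\<^sub>m m p) (b \<cdot>\<^sub>m 1\<^sub>m m)"
  proof (intro cong_four_block_mat)
    show "(a \<cdot>\<^sub>m 1\<^sub>m p) * (b \<cdot>\<^sub>m 1\<^sub>m p) + (2 \<cdot>\<^sub>m B) * ((a - 2) \<cdot>\<^sub>m B\<^sup>T) = ?E"
      using B by (simp add: mult_smult_distrib[of _ p m] mult_smult_distrib[of _ p p]
          mult_smult_assoc_mat[of _ p m] ) (auto intro!: eq_matI simp: algebra_simps)
    show "(2 - a) \<cdot>\<^sub>m B\<^sup>T * (b \<cdot>\<^sub>m 1\<^sub>m p) + (b \<cdot>\<^sub>m 1\<^sub>m m) * ((a - 2) \<cdot>\<^sub>m B\<^sup>T) = 0\<^sub>m m p"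
      using B by (simp add: mult_smult_distrib[of _ m p] mult_smult_distrib[of _ m m]
          mult_smult_assoc_mat[of _ m m]) (auto intro!: eq_matI simp: algebra_simps)
  qed (use B in auto)
  finally have "det (?L * ?M * ?R) = det (four_block_mat ?E (2 \<cdot>\<^sub>m B) (0\<^sub>m m p) (b \<cdot>\<^sub>m 1\<^sub>m m))"
    by simp
  also have "\<dots> = det ?E * b ^ m"
    using B c by (subst det_four_block_mat_lower_left_zero[of _ p _ m]) auto
  finally have "det ?L * det ?M * det ?R = det ?E * b ^ m"
    using c by (metis det_mult mult_carrier_mat)
  moreover have "det ?L = 1"
    using B c by (subst det_four_block_mat_upper_right_zero[of _ p _ m]) auto
  moreover have "det ?R = b ^ p"
    using B c by (subst det_four_block_mat_upper_right_zero[of _ p _ m]) auto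
  ultimately show ?thesis by (simp add: mult.commute)
qed

text \<open>For \<open>d \<noteq> 0\<close> the matrix is \<open>d\<close> times
  \<open>char_matrix A (- c / d)\<close>, and the characteristic polynomial splits over the complex
  numbers. For \<open>d = 0\<close> it is a scalar matrix.\<close>

lemma det_affine:
  fixes A :: "complex mat"
  assumes A: "A \<in> carrier_mat n n"
  shows "det (c \<cdot>\<^sub>m 1\<^sub>m n + d \<cdot>\<^sub>m A) = (\<Prod>l\<in>#proots (char_poly A). c + d * l)"
proof -
  let ?M = "proots (char_poly A)"
  have deg: "degree (char_poly A) = n" "lead_coeff (char_poly A) = 1"
    using degree_monic_char_poly[OF A] by auto
  then have size: "size ?M = n"
    by (simp add: size_proots_complex)
  have poly: "poly (char_poly A) x = (\<Prod>l\<in>#?M. x - l)" for x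
  proof -
    have "char_poly A = (\<Prod>l\<in>#?M. [:- l, 1:])"
      using complex_poly_decompose_multiset[of "char_poly A"] deg by simp
    then have "poly (char_poly A) x = poly (\<Prod>l\<in>#?M. [:- l, 1:]) x" by (rule arg_cong)
    then show ?thesis by (simp add: poly_prod_mset image_mset.compositionality o_def)
  qed
  have scale: "x ^ size N * (\<Prod>l\<in>#N. f l) = (\<Prod>l\<in>#N. x * f l)"
    for x and f :: "complex \<Rightarrow> complex" and N
    by (induction N) (simp_all add: mult_ac)
  show ?thesis
  proof (cases "d = 0")
    case True
    then have "c \<cdot>\<^sub>m 1\<^sub>m n + d \<cdot>\<^sub>m A = c \<cdot>\<^sub>m 1\<^sub>m n"
      using A by (intro eq_matI) auto
    then show ?thesis using True size by (simp add: prod_mset_constant)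
  next
    case False
    have "c \<cdot>\<^sub>m 1\<^sub>m n + d \<cdot>\<^sub>m A = (- d) \<cdot>\<^sub>m (- char_matrix A (- c / d))"
      using A False by (intro eq_matI) (auto simp: char_matrix_def field_simps)
    then have "det (c \<cdot>\<^sub>m 1\<^sub>m n + d \<cdot>\<^sub>m A) = (- d) ^ n * (\<Prod>l\<in>#?M. - c / d - l)"
      using A char_poly_matrix[OF A, of "- c / d"] by (simp add: poly char_matrix_def)
    also have "\<dots> = (\<Prod>l\<in>#?M. (- d) * (- c / d - l))"
      by (simp only: size[symmetric] scale)
    also have "(\<lambda>l. (- d) * (- c / d - l)) = (\<lambda>l. c + d * l)"
      using False by (auto simp: field_simps)
    finally show ?thesis .
  qed
qed

lemma det_idx_mat_two:
  fixes f :: "'a \<Rightarrow> 'a \<Rightarrow> 'c :: comm_ring_1"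
  shows "det (idx_mat [x, y] [x, y] f) = f x x * f y y - f x y * f y x"
proof -
  have "det (idx_mat [x, y] [x, y] f)
    = (\<Sum>i<2. idx_mat [x, y] [x, y] f $$ (i, 0) * cofactor (idx_mat [x, y] [x, y] f) i 0)"
    by (rule laplace_expansion_column) (simp_all add: carrier_matI)
  moreover have "cofactor (idx_mat [x, y] [x, y] f) 0 0 = f y y"
    unfolding cofactor_def by (subst det_single) (auto simp: mat_delete_def)
  moreover have "cofactor (idx_mat [x, y] [x, y] f) 1 0 = - f x y"
    unfolding cofactor_def by (subst det_single) (auto simp: mat_delete_def)
  ultimately show ?thesis
    by (simp add: numeral_2_eq_2 algebra_simps)
qed

lemma det_idx_mat_block_diag:
  fixes f :: "'a \<Rightarrow> 'a \<Rightarrow> 'c :: idom"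
  assumes "\<And>x y. x \<in> set xs \<Longrightarrow> y \<in> set ys \<Longrightarrow> f x y = 0"
  shows "det (idx_mat (xs @ ys) (xs @ ys) f) = det (idx_mat xs xs f) * det (idx_mat ys ys f)"
proof -
  have "idx_mat xs ys f = 0\<^sub>m (length xs) (length ys)"
    by (rule eq_matI) (auto intro: assms)
  then show ?thesis
    unfolding idx_mat_append
    by (intro det_four_block_mat_upper_right_zero[of _ "length xs" _ "length ys"]) (simp_all only: idx_mat_carrier)
qed

section \<open>Distances in the subdivision-vertex join\<close>

text \<open>\<open>h\<close> is a certificate for the distances to \<open>v\<close>:
  \<open>lip\<close> bounds the length of every walk to \<open>v\<close> from below, and following
  \<open>desc\<close> produces a walk that attains the bound.\<close>

lemma graph_dist_eqI:
  fixes h :: "'a \<Rightarrow> nat"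
  assumes G: "pair_graph G" and u: "u \<in> pverts G" and v: "v \<in> pverts G" and h0: "h v = 0"
    and lip: "\<And>x y. (x, y) \<in> parcs G \<Longrightarrow> h x \<le> Suc (h y)"
    and desc: "\<And>x. x \<in> pverts G \<Longrightarrow> x \<noteq> v \<Longrightarrow> \<exists>y. (x, y) \<in> parcs G \<and> h x = Suc (h y)"
  shows "graph_dist G u v = real (h u)"
proof -
  interpret pair_graph G by (rule G)
  have cost: "awalk_cost (\<lambda>_. 1) p = real (length p)" for p :: "('a \<times> 'a) list"
    by (induction p) simp_all
  have lower: "h x \<le> length p" if "awalk x p v" for x p
    using that by (induction p arbitrary: x)
      (auto simp: awalk_Nil_iff awalk_Cons_iff h0 dest!: lip intro: order_trans)
  have "\<exists>p. awalk x p v \<and> length p = n" if "x \<in> pverts G" "h x = n" for x n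
    using that
  proof (induction n arbitrary: x)
    case 0
    \<comment> \<open>At any other vertex \<open>desc\<close> would make \<open>h x\<close> a
      successor.\<close>
    then have "x = v" using desc by fastforce
    then show ?case using v by (auto simp: awalk_Nil_iff)
  next
    case (Suc n)
    then obtain y where y: "(x, y) \<in> parcs G" "h y = n"
      using desc h0 by (metis nat.distinct(1) nat.inject)
    then obtain p where "awalk y p v" "length p = n"
      using Suc.IH in_arcsD2 by blast
    then show ?case using y
      by (intro exI[of _ "(x, y) # p"]) (auto simp: awalk_Cons_iff)
  qed
  then obtain p where p: "awalk u p v" "length p = h u" using u by blast
  have "\<mu> (\<lambda>_. 1) u v = ereal (h u)"
  proof (rule antisym)
    show "\<mu> (\<lambda>_. 1) u v \<le> ereal (h u)"
      using min_cost_le_walk_cost[OF p(1), of "\<lambda>_. 1"] p(2) by (simp add: cost)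
    show "ereal (h u) \<le> \<mu> (\<lambda>_. 1) u v"
      unfolding \<mu>_def using lower by (auto intro!: INF_greatest simp: cost)
  qed
  then show ?thesis by (simp add: graph_dist_def)
qed

definition ends :: "'a + 'a set \<Rightarrow> 'a set" where
  "ends = case_sum (\<lambda>v. {v}) id"

definition level :: "'a + 'b \<Rightarrow> nat" where
  "level = case_sum (\<lambda>_. 0) (\<lambda>_. 1)"

lemma ends_simps [simp]: "ends (Inl v) = {v}" "ends (Inr e) = e"
  by (simp_all add: ends_def)

lemma level_simps [simp]: "level (Inl v) = 0" "level (Inr e) = 1"
  by (simp_all add: level_def)

lemma Plus_mem_iff [simp]:
  "Inl x \<in> A <+> B \<longleftrightarrow> x \<in> A" "Inr y \<in> A <+> B \<longleftrightarrow> y \<in> B"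
  by auto

lemma pverts_subdivision_vertex_join:
  "pverts (subdivision_vertex_join G1 G2)
    = (pverts G1 <+> uedges G1) <+> (pverts G2 <+> uedges G2)"
  by (simp add: subdivision_vertex_join_def subdivision_graph_def)

section \<open>Incidence between vertices and edges of a simple graph\<close>

context
  fixes G :: "'a pair_pre_digraph"
  assumes G: "pair_graph G"
begin

interpretation pair_graph G by (rule G)

lemma uedgesE:
  assumes "e \<in> uedges G"
  obtains u v where "e = {u, v}" "u \<noteq> v" "(u, v) \<in> parcs G" "u \<in> pverts G" "v \<in> pverts G"
  using assms pair_no_loops
  by (fastforce simp: uedges_def dest: in_arcsD1 in_arcsD2)

lemma doubleton_uedges_iff: "{u, v} \<in> uedges G \<longleftrightarrow> (u, v) \<in> parcs G"
  using pair_sym_arcs by (auto simp: uedges_def doubleton_eq_iff symmetric_def sym_def)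

lemma card_uedge: "e \<in> uedges G \<Longrightarrow> card e = 2"
  by (elim uedgesE) simp

lemma uedge_vertex: "e \<in> uedges G \<Longrightarrow> \<exists>u\<in>pverts G. u \<in> e"
  by (elim uedgesE) auto

text \<open>Distinct edges of a simple graph share at most one endpoint. The overlaps 2, 1, 0 will
  give the midpoint distances 0, 2, 4.\<close>

lemma card_uedge_Int:
  assumes "e \<in> uedges G" "f \<in> uedges G"
  shows "card (e \<inter> f) = (if e = f then 2 else if e \<inter> f = {} then 0 else 1)"
proof -
  have "card (e \<inter> f) = 1" if "e \<noteq> f" "e \<inter> f \<noteq> {}"
  proof -
    obtain u v x y where "e = {u, v}" "u \<noteq> v" "f = {x, y}" "x \<noteq> y"
      using assms by (metis uedgesE)
    then show ?thesis using that
      by (cases "u = x"; cases "u = y"; cases "v = x"; cases "v = y") auto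
  qed
  then show ?thesis using assms card_uedge by auto
qed

text \<open>Only the edge \<open>{u, v}\<close> can contain both vertices. This is the off-diagonal
  part of the product of the incidence matrix with its transpose.\<close>

lemma card_uedges_containing_both:
  assumes "u \<noteq> v"
  shows "card {e \<in> uedges G. u \<in> e \<and> v \<in> e} = of_bool ((u, v) \<in> parcs G)"
proof -
  have "e = {u, v}" if "e \<in> uedges G" "u \<in> e" "v \<in> e" for e
    using that assms by (elim uedgesE) auto
  then have "{e \<in> uedges G. u \<in> e \<and> v \<in> e} = {e. e = {u, v} \<and> {u, v} \<in> uedges G}"
    by blast
  then show ?thesis by (simp add: doubleton_uedges_iff)
qed

text \<open>Sending \<open>(v, w)\<close> to \<open>{v, w}\<close> is injective on the arcs that
  leave \<open>v\<close>, because the tail is fixed.\<close>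

lemma card_uedges_containing:
  "card {e \<in> uedges G. v \<in> e} = out_degree (with_proj G) v"
proof -
  have "{e \<in> uedges G. v \<in> e} = (\<lambda>(x, y). {x, y}) ` out_arcs (with_proj G) v"
  proof (intro equalityI subsetI)
    fix e assume "e \<in> {e \<in> uedges G. v \<in> e}"
    then have e: "e \<in> uedges G" "v \<in> e" by simp_all
    obtain x y where xy: "e = {x, y}" using e(1) by (elim uedgesE)
    then obtain w where "e = {v, w}" using e(2) by (cases "v = x") auto
    moreover from this have "(v, w) \<in> parcs G" using e(1) by (simp add: doubleton_uedges_iff)
    ultimately
    show "e \<in> (\<lambda>(x, y). {x, y}) ` out_arcs (with_proj G) v"
      by (intro image_eqI[of _ _ "(v, w)"]) (auto simp: out_arcs_def)
  qed (auto simp: out_arcs_def uedges_def)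
  moreover have "inj_on (\<lambda>(x, y). {x, y}) (out_arcs (with_proj G) v)"
    by (auto simp: inj_on_def out_arcs_def doubleton_eq_iff)
  ultimately show ?thesis by (simp add: out_degree_def card_image)
qed

text \<open>Double counting of the incidences between \<open>X\<close> and the edges. It yields both
  the handshake identity and the overlap sums of regular graphs.\<close>

lemma sum_uedges_card_Int:
  assumes "finite X"
  shows "(\<Sum>e\<in>uedges G. card (X \<inter> e)) = (\<Sum>v\<in>X. out_degree (with_proj G) v)"
proof -
  have "(\<Sum>e\<in>uedges G. card (X \<inter> e)) = (\<Sum>e\<in>uedges G. \<Sum>v\<in>X. of_bool (v \<in> e))"
    using assms by (simp add: Int_def)
  also have "\<dots> = (\<Sum>v\<in>X. \<Sum>e\<in>uedges G. of_bool (v \<in> e))" by (rule sum.swap)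
  also have "\<dots> = (\<Sum>v\<in>X. card {e \<in> uedges G. v \<in> e})"
    using finite_uedges[OF G] by (simp add: Int_def)
  finally show ?thesis by (simp add: card_uedges_containing)
qed

end

text \<open>
  Two vertices of the same subdivision graph, as seen in the join: two original vertices
  are always at distance at most 2 through the other graph.
\<close>
definition side_dist :: "'a + 'a set \<Rightarrow> 'a + 'a set \<Rightarrow> nat" where
  "side_dist x y = 2 + level x + level y - 2 * card (ends x \<inter> ends y)"

lemma side_dist_Inl [simp]:
  "side_dist (Inl u) (Inl v) = (if u = v then 0 else 2)"
  "side_dist (Inl u) (Inr e) = (if u \<in> e then 1 else 3)"
  "side_dist (Inr e) (Inl u) = (if u \<in> e then 1 else 3)"
  by (simp_all add: side_dist_def)

context
  fixes G :: "'a pair_pre_digraph"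
  assumes G: "pair_graph G"
begin

lemma side_dist_Inr:
  assumes "e \<in> uedges G" "f \<in> uedges G"
  shows "side_dist (Inr e) (Inr f) = (if e = f then 0 else if e \<inter> f = {} then 4 else 2)"
  using card_uedge_Int[OF G assms] by (simp add: side_dist_def)

text \<open>The natural number subtraction in \<open>side_dist\<close> never truncates on vertices
  of the graph.\<close>

lemma real_side_dist:
  assumes "x \<in> pverts G <+> uedges G" "y \<in> pverts G <+> uedges G"
  shows "real (side_dist x y) = 2 + real (level x) + real (level y) - 2 * real (card (ends x \<inter> ends y))"
  using assms by (auto simp: side_dist_Inr card_uedge_Int[OF G])

lemma side_dist_self: "x \<in> pverts G <+> uedges G \<Longrightarrow> side_dist x x = 0"
  by (auto simp: side_dist_Inr)

lemma side_dist_lipschitz: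
  assumes "(x, y) \<in> parcs (subdivision_graph G)" "z \<in> pverts G <+> uedges G"
  shows "side_dist x z \<le> Suc (side_dist y z)"
  using assms by (auto simp: subdivision_graph_def side_dist_Inr split: if_splits)

text \<open>The Lipschitz condition for arcs between the two sides rests on these bounds: an
  original vertex of the opposite side is at distance \<open>1 + level z\<close> from
  \<open>z\<close>, and \<open>side_dist (Inl u) z\<close> may differ from this by at most
  1.\<close>

lemma level_le_side_dist:
  assumes "z \<in> pverts G <+> uedges G"
  shows "side_dist (Inl u) z \<le> 2 + level z" "level z \<le> side_dist (Inl u) z"
  using assms by auto

text \<open>A midpoint always moves to one of its endpoints, one lying in \<open>ends z\<close> if
  possible. An original vertex moves to \<open>z\<close> itself if \<open>z\<close> is the midpoint
  of an edge at it; otherwise a detour through the other graph, of length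
  \<open>2 + level z\<close>, is shortest.\<close>

lemma side_dist_descent:
  assumes x: "x \<in> pverts G <+> uedges G" and z: "z \<in> pverts G <+> uedges G" and "x \<noteq> z"
  shows "(\<exists>y. (x, y) \<in> parcs (subdivision_graph G) \<and> side_dist x z = Suc (side_dist y z))
    \<or> (\<exists>u\<in>pverts G. x = Inl u) \<and> side_dist x z = 2 + level z"
  using x
proof (elim PlusE)
  fix u assume u: "x = Inl u" "u \<in> pverts G"
  show ?thesis
  proof (cases "\<exists>e. z = Inr e \<and> u \<in> e")
    case True
    then show ?thesis using u z
      by (auto simp: subdivision_graph_def side_dist_Inr)
  next
    case False
    then show ?thesis using u z \<open>x \<noteq> z\<close> by auto
  qed
next
  fix e assume e: "x = Inr e" "e \<in> uedges G"
  obtain u where u: "u \<in> e" using e(2) by (auto dest: uedge_vertex[OF G])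
  have step: "(x, Inl v) \<in> parcs (subdivision_graph G)" if "v \<in> e" for v
    using that e by (auto simp: subdivision_graph_def)
  consider v where "z = Inl v" "v \<in> e" | v where "z = Inl v" "v \<notin> e"
    | f v where "z = Inr f" "f \<in> uedges G" "v \<in> e" "v \<in> f"
    | f where "z = Inr f" "f \<in> uedges G" "e \<inter> f = {}"
    using z by (cases z) (simp_all, blast+)
  then show ?thesis
  proof cases
    case 1
    then show ?thesis using e step[of v] by (intro disjI1 exI[of _ "Inl v"]) auto
  next
    case 2
    then show ?thesis using e u step[of u] by (intro disjI1 exI[of _ "Inl u"]) auto
  next
    case 3
    then show ?thesis using e \<open>x \<noteq> z\<close> step[of v]
      by (intro disjI1 exI[of _ "Inl v"]) (auto simp: side_dist_Inr)
  next
    case 4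
    then show ?thesis using e u step[of u]
      by (intro disjI1 exI[of _ "Inl u"]) (auto simp: side_dist_Inr)
  qed
qed

end

fun join_dist :: "('a + 'a set) + ('b + 'b set) \<Rightarrow> ('a + 'a set) + ('b + 'b set) \<Rightarrow> nat" where
  "join_dist (Inl x) (Inl y) = side_dist x y"
| "join_dist (Inr x) (Inr y) = side_dist x y"
| "join_dist (Inl x) (Inr y) = 1 + level x + level y"
| "join_dist (Inr x) (Inl y) = 1 + level x + level y"

lemma graph_dist_subdivision_vertex_join:
  assumes G1: "pair_graph G1" "pverts G1 \<noteq> {}" and G2: "pair_graph G2" "pverts G2 \<noteq> {}"
    and x: "x \<in> pverts (subdivision_vertex_join G1 G2)" and z: "z \<in> pverts (subdivision_vertex_join G1 G2)"
  shows "graph_dist (subdivision_vertex_join G1 G2) x z = real (join_dist x z)"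
proof (rule graph_dist_eqI[OF pair_graph_subdivision_vertex_join[OF G1(1) G2(1)] x z])
  let ?J = "subdivision_vertex_join G1 G2"
  obtain v1 v2 where v: "v1 \<in> pverts G1" "v2 \<in> pverts G2" using G1 G2 by blast
  show "join_dist z z = 0"
    using z side_dist_self[OF G1(1)] side_dist_self[OF G2(1)]
    by (cases z) (simp_all add: pverts_subdivision_vertex_join)
  have arcs: "(Inl x, Inl y) \<in> parcs ?J \<longleftrightarrow> (x, y) \<in> parcs (subdivision_graph G1)"
    "(Inr x', Inr y') \<in> parcs ?J \<longleftrightarrow> (x', y') \<in> parcs (subdivision_graph G2)"
    "(Inl x, Inr y') \<in> parcs ?J \<longleftrightarrow> x \<in> Inl ` pverts G1 \<and> y' \<in> Inl ` pverts G2"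
    "(Inr x', Inl y) \<in> parcs ?J \<longleftrightarrow> x' \<in> Inl ` pverts G2 \<and> y \<in> Inl ` pverts G1"
    for x y x' y' by (auto simp: subdivision_vertex_join_def)
  have level: "level y \<le> Suc (level x)" if "(x, y) \<in> parcs (subdivision_graph G)"
    for x y :: "'c + 'c set" and G
    using that by (auto simp: subdivision_graph_def)
  have flip: "(y, x) \<in> parcs (subdivision_graph G)" if "(x, y) \<in> parcs (subdivision_graph G)"
    for x y :: "'c + 'c set" and G
    using that by (auto simp: subdivision_graph_def)
  show "join_dist x z \<le> Suc (join_dist y z)" if xy: "(x, y) \<in> parcs ?J" for x y
  proof (cases z)
    case [simp]: (Inl z')
    have z': "z' \<in> pverts G1 <+> uedges G1" using z by (simp add: pverts_subdivision_vertex_join)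
    show ?thesis using xy z' side_dist_lipschitz[OF G1(1) _ z'] level_le_side_dist[OF G1(1) z'] level[OF flip]
      by (cases x; cases y) (auto simp: arcs)
  next
    case [simp]: (Inr z')
    have z': "z' \<in> pverts G2 <+> uedges G2" using z by (simp add: pverts_subdivision_vertex_join)
    show ?thesis using xy z' side_dist_lipschitz[OF G2(1) _ z'] level_le_side_dist[OF G2(1) z'] level[OF flip]
      by (cases x; cases y) (auto simp: arcs)
  qed
  \<comment> \<open>From the side opposite to \<open>z\<close>, \<open>down\<close> reaches an
    original vertex, and \<open>near\<close> supplies the original vertex on the side of
    \<open>z\<close> to cross to.\<close>
  have down: "(\<exists>u\<in>pverts G. x = Inl u) \<or> (\<exists>u. (x, Inl u) \<in> parcs (subdivision_graph G) \<and> level x = 1)"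
    if "pair_graph G" "x \<in> pverts G <+> uedges G" for x :: "'c + 'c set" and G
    using that(2) uedge_vertex[OF that(1)] by (fastforce simp: subdivision_graph_def)
  have near: "\<exists>u\<in>pverts G. side_dist (Inl u) z = level z"
    if "pair_graph G" "z \<in> pverts G <+> uedges G" for z :: "'c + 'c set" and G
    using that(2) uedge_vertex[OF that(1)] by fastforce
  show "\<exists>y. (x, y) \<in> parcs ?J \<and> join_dist x z = Suc (join_dist y z)" if x: "x \<in> pverts ?J" "x \<noteq> z" for x
  proof (cases z)
    case [simp]: (Inl z')
    have z': "z' \<in> pverts G1 <+> uedges G1" using z by (simp add: pverts_subdivision_vertex_join)
    show ?thesis
    proof (cases x)
      case [simp]: (Inl x')
      have x': "x' \<in> pverts G1 <+> uedges G1" "x' \<noteq> z'" using x by (simp_all add: pverts_subdivision_vertex_join)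
      from side_dist_descent[OF G1(1) x'(1) z' x'(2)] show ?thesis
      proof
        assume "\<exists>y. (x', y) \<in> parcs (subdivision_graph G1) \<and> side_dist x' z' = Suc (side_dist y z')"
        then obtain y where "(x', y) \<in> parcs (subdivision_graph G1)" "side_dist x' z' = Suc (side_dist y z')" by blast
        then show ?thesis by (intro exI[of _ "Inl y"]) (simp add: arcs)
      next
        assume "(\<exists>u\<in>pverts G1. x' = Inl u) \<and> side_dist x' z' = 2 + level z'"
        \<comment> \<open>After the step to \<open>v2\<close> on the opposite side, a distance of
          \<open>1 + level z'\<close> is left.\<close>
        then show ?thesis using v by (intro exI[of _ "Inr (Inl v2)"]) (auto simp: arcs)
      qed
    next
      case [simp]: (Inr x')
      have x': "x' \<in> pverts G2 <+> uedges G2" using x by (simp add: pverts_subdivision_vertex_join)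
      from down[OF G2(1) x'] show ?thesis
      proof
        assume "\<exists>u\<in>pverts G2. x' = Inl u"
        moreover obtain u where "u \<in> pverts G1" "side_dist (Inl u) z' = level z'"
          using near[OF G1(1) z'] by blast
        ultimately show ?thesis by (intro exI[of _ "Inl (Inl u)"]) (auto simp: arcs)
      next
        assume "\<exists>u. (x', Inl u) \<in> parcs (subdivision_graph G2) \<and> level x' = 1"
        then obtain u where "(x', Inl u) \<in> parcs (subdivision_graph G2)" "level x' = 1" by blast
        then show ?thesis by (intro exI[of _ "Inr (Inl u)"]) (auto simp: arcs)
      qed
    qed
  next
    case [simp]: (Inr z')
    have z': "z' \<in> pverts G2 <+> uedges G2" using z by (simp add: pverts_subdivision_vertex_join)
    show ?thesis
    proof (cases x)
      case [simp]: (Inr x')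
      have x': "x' \<in> pverts G2 <+> uedges G2" "x' \<noteq> z'" using x by (simp_all add: pverts_subdivision_vertex_join)
      from side_dist_descent[OF G2(1) x'(1) z' x'(2)] show ?thesis
      proof
        assume "\<exists>y. (x', y) \<in> parcs (subdivision_graph G2) \<and> side_dist x' z' = Suc (side_dist y z')"
        then obtain y where "(x', y) \<in> parcs (subdivision_graph G2)" "side_dist x' z' = Suc (side_dist y z')" by blast
        then show ?thesis by (intro exI[of _ "Inr y"]) (simp add: arcs)
      next
        assume "(\<exists>u\<in>pverts G2. x' = Inl u) \<and> side_dist x' z' = 2 + level z'"
        then show ?thesis using v by (intro exI[of _ "Inl (Inl v1)"]) (auto simp: arcs)
      qed
    next
      case [simp]: (Inl x')
      have x': "x' \<in> pverts G1 <+> uedges G1" using x by (simp add: pverts_subdivision_vertex_join)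
      from down[OF G1(1) x'] show ?thesis
      proof
        assume "\<exists>u\<in>pverts G1. x' = Inl u"
        moreover obtain u where "u \<in> pverts G2" "side_dist (Inl u) z' = level z'"
          using near[OF G2(1) z'] by blast
        ultimately show ?thesis by (intro exI[of _ "Inr (Inl u)"]) (auto simp: arcs)
      next
        assume "\<exists>u. (x', Inl u) \<in> parcs (subdivision_graph G1) \<and> level x' = 1"
        then obtain u where "(x', Inl u) \<in> parcs (subdivision_graph G1)" "level x' = 1" by blast
        then show ?thesis by (intro exI[of _ "Inl (Inl u)"]) (auto simp: arcs)
      qed
    qed
  qed
qed

section \<open>Regular graphs\<close>

context
  fixes G :: "'a pair_pre_digraph" and r :: nat
  assumes G: "regular_graph G r"
begin

lemma pair_graph_regular: "pair_graph G"
  using G by (simp add: regular_graph_def)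

lemma finite_pverts_regular: "finite (pverts G)"
  using pair_graph_regular
  by (simp add: pair_graph_def pair_digraph_def pair_fin_digraph_def pair_fin_digraph_axioms_def)

lemma card_uedges_containing_regular: "v \<in> pverts G \<Longrightarrow> card {e \<in> uedges G. v \<in> e} = r"
  using G card_uedges_containing[OF pair_graph_regular] by (simp add: regular_graph_def)

lemma ends_subset_regular: "x \<in> pverts G <+> uedges G \<Longrightarrow> ends x \<subseteq> pverts G"
  using uedges_subset[OF pair_graph_regular] by (cases x) auto

lemma card_ends_regular: "x \<in> pverts G <+> uedges G \<Longrightarrow> card (ends x) = 1 + level x"
  using card_uedge[OF pair_graph_regular] by auto

text \<open>Together with \<open>sum_uedges_overlap\<close> this shows that the overlap sums over
  one cell depend on \<open>x\<close> only through its level, which is the equitability of the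
  cells.\<close>

lemma sum_pverts_overlap:
  assumes x: "x \<in> pverts G <+> uedges G"
  shows "(\<Sum>v\<in>pverts G. card (ends x \<inter> {v})) = 1 + level x"
proof -
  have "(\<Sum>v\<in>pverts G. card (ends x \<inter> {v})) = (\<Sum>v\<in>pverts G. of_bool (v \<in> ends x))"
    by (intro sum.cong) auto
  also have "\<dots> = card (ends x)"
    using ends_subset_regular[OF x] finite_pverts_regular by (simp add: Int_absorb1)
  finally show ?thesis by (simp add: card_ends_regular[OF x])
qed

text \<open>By double counting: each of the \<open>1 + level x\<close> ends of \<open>x\<close> lies
  on \<open>r\<close> edges.\<close>

lemma sum_uedges_overlap:
  assumes x: "x \<in> pverts G <+> uedges G"
  shows "(\<Sum>e\<in>uedges G. card (ends x \<inter> e)) = r * (1 + level x)"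
proof -
  have "(\<Sum>e\<in>uedges G. card (ends x \<inter> e)) = (\<Sum>v\<in>ends x. out_degree (with_proj G) v)"
    using finite_subset[OF ends_subset_regular[OF x] finite_pverts_regular]
    by (rule sum_uedges_card_Int[OF pair_graph_regular])
  also have "\<dots> = (\<Sum>v\<in>ends x. r)"
    using G ends_subset_regular[OF x] by (intro sum.cong) (auto simp: regular_graph_def)
  finally show ?thesis by (simp add: card_ends_regular[OF x] mult.commute)
qed

lemma handshake: "2 * card (uedges G) = card (pverts G) * r"
proof -
  have "(\<Sum>e\<in>uedges G. card (pverts G \<inter> e)) = (\<Sum>e\<in>uedges G. 2)"
    using uedges_subset[OF pair_graph_regular] card_uedge[OF pair_graph_regular]
    by (intro sum.cong) (simp_all add: Int_absorb1)
  moreover have "(\<Sum>v\<in>pverts G. out_degree (with_proj G) v) = (\<Sum>v\<in>pverts G. r)"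
    using G by (intro sum.cong) (auto simp: regular_graph_def)
  ultimately show ?thesis
    using sum_uedges_card_Int[OF pair_graph_regular finite_pverts_regular] by simp
qed

lemma sum_Plus_regular:
  "(\<Sum>y\<in>pverts G <+> uedges G. f y) = (\<Sum>v\<in>pverts G. f (Inl v)) + (\<Sum>e\<in>uedges G. f (Inr e))"
  using finite_pverts_regular finite_uedges[OF pair_graph_regular] by (simp add: sum.Plus o_def)

lemma sum_level:
  "(\<Sum>y\<in>pverts G <+> uedges G. c + real (level y))
    = c * (real (card (pverts G)) + real (card (uedges G))) + real (card (uedges G))"
  by (simp add: sum_Plus_regular algebra_simps)

text \<open>The closed form of \<open>side_dist\<close> is summed termwise. Each of the
  \<open>1 + level x\<close> ends contributes overlap 1 from the original vertices and
  \<open>r\<close> from the midpoints.\<close>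

lemma sum_side_dist:
  assumes x: "x \<in> pverts G <+> uedges G"
  shows "(\<Sum>y\<in>pverts G <+> uedges G. real (side_dist x y))
    = (2 + real (level x)) * (real (card (pverts G)) + real (card (uedges G)))
      + real (card (uedges G)) - 2 * (1 + real (level x)) * (1 + real r)"
proof -
  have "(\<Sum>y\<in>pverts G <+> uedges G. real (side_dist x y))
      = (\<Sum>y\<in>pverts G <+> uedges G. (2 + real (level x)) + real (level y))
        - 2 * real (\<Sum>y\<in>pverts G <+> uedges G. card (ends x \<inter> ends y))"
    by (simp add: real_side_dist[OF pair_graph_regular x] sum_subtractf sum_distrib_left)
  also have "(\<Sum>y\<in>pverts G <+> uedges G. card (ends x \<inter> ends y)) = (1 + level x) * (1 + r)"
    using sum_pverts_overlap[OF x] sum_uedges_overlap[OF x] by (simp add: sum_Plus_regular algebra_simps)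
  finally show ?thesis by (simp only: sum_level) (simp add: algebra_simps)
qed

text \<open>The entries of \<open>B B\<^sup>T = A + r 1\<close>: distinct vertices share only the
  edge joining them, and a vertex lies on \<open>r\<close> edges. The general semiring serves both
  the real and the complex use.\<close>

lemma incidence_gram:
  fixes u v :: 'a
  assumes "u \<in> pverts G"
  shows "(\<Sum>e\<in>uedges G. of_bool (u \<in> e) * of_bool (v \<in> e))
    = (of_bool ((u, v) \<in> parcs G) + of_nat r * of_bool (u = v) :: 'c :: semiring_1)"
proof -
  have "(\<Sum>e\<in>uedges G. of_bool (u \<in> e) * of_bool (v \<in> e))
      = (of_nat (card {e \<in> uedges G. u \<in> e \<and> v \<in> e}) :: 'c)"
    using finite_uedges[OF pair_graph_regular]
    by (simp flip: of_bool_conj add: Int_def)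
  \<comment> \<open>A loop would make \<open>{u}\<close> an edge with a single endpoint.\<close>
  moreover have "(u, u) \<notin> parcs G"
    using doubleton_uedges_iff[OF pair_graph_regular, of u u] card_uedge[OF pair_graph_regular, of "{u}"] by auto
  ultimately show ?thesis
    using card_uedges_containing_both[OF pair_graph_regular, of u v] card_uedges_containing_regular[OF assms]
    by (cases "u = v") simp_all
qed

text \<open>For a real eigenvector \<open>w\<close>, the quadratic form of \<open>A + r 1\<close> at
  \<open>w\<close> is the squared norm of \<open>B\<^sup>T w\<close>, hence nonnegative. This will
  keep the radicands nonnegative.\<close>

lemma adjacency_eigenvalue_ge:
  assumes vs: "distinct vs" "set vs = pverts G"
    and l: "complex_of_real l \<in># eigenvalue_mset (adjacency_matrix G vs)"
  shows "0 \<le> l + real r"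
proof -
  let ?A = "adjacency_matrix G vs" and ?n = "length vs"
  have A: "?A \<in> carrier_mat ?n ?n" by (simp add: adjacency_matrix_def)
  have "char_poly (map_mat complex_of_real ?A) \<noteq> 0"
    using degree_monic_char_poly[of "map_mat complex_of_real ?A" ?n] A by auto
  then have "poly (char_poly (map_mat complex_of_real ?A)) (complex_of_real l) = 0"
    using l by (simp add: eigenvalue_mset_def)
  \<comment> \<open>Since \<open>l\<close> is real, it is a root of the real characteristic
    polynomial and has a real eigenvector.\<close>
  then have "poly (char_poly ?A) l = 0"
    by (simp add: of_real_hom.char_poly_hom[OF A])
  then have "eigenvalue ?A l" by (simp add: eigenvalue_root_char_poly[OF A])
  then obtain w where w: "w \<in> carrier_vec ?n" "w \<noteq> 0\<^sub>v ?n" "?A *\<^sub>v w = l \<cdot>\<^sub>v w"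
    using A by (auto simp: eigenvalue_def eigenvector_def)
  define f where "f i = w $ i" for i
  let ?I = "{..<?n}"
  have ev: "(\<Sum>j\<in>?I. of_bool ((vs ! i, vs ! j) \<in> parcs G) * f j) = l * f i" if "i \<in> ?I" for i
    using arg_cong[OF w(3), of "\<lambda>u. u $ i"] that w(1) A
    by (simp add: adjacency_matrix_def scalar_prod_def f_def lessThan_atLeast0)
  have delta: "(\<Sum>j\<in>?I. of_bool (vs ! i = vs ! j) * f j) = f i" if "i \<in> ?I" for i
  proof -
    have "?I \<inter> {j. vs ! i = vs ! j} = {i}" using that vs(1) by (auto simp: nth_eq_iff_index_eq)
    then show ?thesis by simp
  qed
  have gram: "(\<Sum>e\<in>uedges G. c * (of_bool (vs ! i \<in> e) * of_bool (vs ! j \<in> e)))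
      = c * (of_bool ((vs ! i, vs ! j) \<in> parcs G) + real r * of_bool (vs ! i = vs ! j))"
    if "i \<in> ?I" for c i j
  proof -
    have "vs ! i \<in> pverts G" using that vs(2) nth_mem by blast
    then show ?thesis unfolding sum_distrib_left[symmetric] by (simp only: incidence_gram)
  qed
  have "0 \<le> (\<Sum>e\<in>uedges G. (\<Sum>i\<in>?I. of_bool (vs ! i \<in> e) * f i)\<^sup>2)"
    by (intro sum_nonneg) simp
  also have "\<dots>
      = (\<Sum>e\<in>uedges G. \<Sum>i\<in>?I. \<Sum>j\<in>?I. f i * f j * (of_bool (vs ! i \<in> e) * of_bool (vs ! j \<in> e)))"
    by (simp only: power2_eq_square sum_product mult_ac)
  also have "\<dots> = (\<Sum>i\<in>?I. \<Sum>e\<in>uedges G. \<Sum>j\<in>?I. f i * f j * (of_bool (vs ! i \<in> e) * of_bool (vs ! j \<in> e)))"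
    by (rule sum.swap)
  also have "\<dots> = (\<Sum>i\<in>?I. \<Sum>j\<in>?I. \<Sum>e\<in>uedges G. f i * f j * (of_bool (vs ! i \<in> e) * of_bool (vs ! j \<in> e)))"
    by (intro sum.cong refl sum.swap)
  also have "\<dots> = (\<Sum>i\<in>?I. \<Sum>j\<in>?I. f i * f j
      * (of_bool ((vs ! i, vs ! j) \<in> parcs G) + real r * of_bool (vs ! i = vs ! j)))"
    by (intro sum.cong refl) (rule gram)
  also have "\<dots> = (\<Sum>i\<in>?I. f i * ((\<Sum>j\<in>?I. of_bool ((vs ! i, vs ! j) \<in> parcs G) * f j)
      + real r * (\<Sum>j\<in>?I. of_bool (vs ! i = vs ! j) * f j)))"
    by (simp only: sum_distrib_left sum.distrib[symmetric] distrib_left mult_ac)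
  also have "\<dots> = (\<Sum>i\<in>?I. f i * (l * f i + real r * f i))"
    by (intro sum.cong refl) (simp only: ev delta)
  also have "\<dots> = (l + real r) * (\<Sum>i\<in>?I. (f i)\<^sup>2)"
    by (simp add: sum_distrib_left power2_eq_square algebra_simps)
  finally have "0 \<le> (l + real r) * (\<Sum>i\<in>?I. (f i)\<^sup>2)" .
  moreover have "0 < (\<Sum>i\<in>?I. (f i)\<^sup>2)"
  proof -
    obtain i where "i < ?n" "f i \<noteq> 0" using w(1,2) by (auto simp: f_def vec_eq_iff)
    then show ?thesis by (intro sum_pos2[of _ i]) auto
  qed
  ultimately show ?thesis by (simp add: zero_le_mult_iff)
qed

text \<open>This is the matrix of \<open>det_incidence_block\<close> with \<open>a + 2\<close> for
  \<open>a\<close>, as an original vertex overlaps itself once and so adds 2 to the diagonal. Then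
  \<open>incidence_gram\<close> and \<open>det_affine\<close> turn the remaining determinant into
  the product. The factor \<open>b ^ length vs\<close> stays on the left, so that neither
  \<open>b = 0\<close> nor fewer edges than vertices is an exception.\<close>

lemma det_side:
  assumes vs: "distinct vs" "set vs = pverts G" and es: "distinct es" "set es = uedges G"
  defines "xs \<equiv> map Inl vs @ map Inr es"
  shows "det (idx_mat xs xs (\<lambda>x y. (if level x = 0 then a else b) * of_bool (x = y)
             + 2 * of_nat (card (ends x \<inter> ends y)))) * b ^ length vs
    = b ^ length es * (\<Prod>l\<in>#eigenvalue_mset (adjacency_matrix G vs). (a + 2) * b + 2 * a * (l + of_nat r))"
proof -
  let ?f = "\<lambda>x y. (if level x = 0 then a else b) * of_bool (x = y) + 2 * of_nat (card (ends x \<inter> ends y))"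
  let ?p = "length vs" and ?m = "length es"
  define B where "B = idx_mat vs es (\<lambda>v e. of_bool (v \<in> e) :: complex)"
  have B: "B \<in> carrier_mat ?p ?m" by (simp add: B_def)
  let ?A = "map_mat complex_of_real (adjacency_matrix G vs)"
  have A: "?A \<in> carrier_mat ?p ?p" by (simp add: adjacency_matrix_def)
  have BT: "B\<^sup>T = idx_mat es vs (\<lambda>e v. of_bool (v \<in> e))"
    unfolding B_def by (rule eq_matI) auto
  have "B * B\<^sup>T = idx_mat vs vs (\<lambda>u v. of_bool ((u, v) \<in> parcs G) + of_nat r * of_bool (u = v))"
    unfolding BT unfolding B_def idx_mat_mult[OF es(1)]
    by (rule idx_mat_cong) (simp only: es(2) vs(2) incidence_gram)
  also have "\<dots> = ?A + of_nat r \<cdot>\<^sub>m 1\<^sub>m ?p"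
    using vs(1) by (intro eq_matI) (auto simp: adjacency_matrix_def nth_eq_iff_index_eq)
  finally have BBT: "B * B\<^sup>T = \<dots>" .
  have BTB: "B\<^sup>T * B = idx_mat es es (\<lambda>e f. of_nat (card (e \<inter> f)))"
    unfolding BT unfolding B_def idx_mat_mult[OF vs(1)]
  proof (rule idx_mat_cong)
    fix e f assume e: "e \<in> set es" "f \<in> set es"
    have "(\<Sum>v\<in>set vs. of_bool (v \<in> e) * of_bool (v \<in> f)) = (of_nat (card {v \<in> set vs. v \<in> e \<and> v \<in> f}) :: complex)"
      by (simp flip: of_bool_conj add: Int_def)
    also have "{v \<in> set vs. v \<in> e \<and> v \<in> f} = e \<inter> f"
      using e es(2) vs(2) uedges_subset[OF pair_graph_regular] by blast
    finally show "(\<Sum>v\<in>set vs. of_bool (v \<in> e) * of_bool (v \<in> f)) = (of_nat (card (e \<inter> f)) :: complex)" .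
  qed
  have "idx_mat xs xs ?f = four_block_mat ((a + 2) \<cdot>\<^sub>m 1\<^sub>m ?p) (2 \<cdot>\<^sub>m B) (2 \<cdot>\<^sub>m B\<^sup>T) (b \<cdot>\<^sub>m 1\<^sub>m ?m + 2 \<cdot>\<^sub>m (B\<^sup>T * B))"
    unfolding xs_def idx_mat_append idx_mat_map BTB
  proof (intro cong_four_block_mat)
    show "idx_mat vs vs (\<lambda>x y. ?f (Inl x) (Inl y)) = (a + 2) \<cdot>\<^sub>m 1\<^sub>m ?p"
      using vs(1) by (intro eq_matI) (auto simp: nth_eq_iff_index_eq)
    show "idx_mat es es (\<lambda>x y. ?f (Inr x) (Inr y)) = b \<cdot>\<^sub>m 1\<^sub>m ?m + 2 \<cdot>\<^sub>m idx_mat es es (\<lambda>e f. of_nat (card (e \<inter> f)))"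
      using es(1) by (intro eq_matI) (auto simp: nth_eq_iff_index_eq)
    show "idx_mat vs es (\<lambda>x y. ?f (Inl x) (Inr y)) = 2 \<cdot>\<^sub>m B"
      unfolding B_def by (intro eq_matI) auto
    show "idx_mat es vs (\<lambda>x y. ?f (Inr x) (Inl y)) = 2 \<cdot>\<^sub>m B\<^sup>T"
      unfolding BT by (intro eq_matI) auto
  qed
  then have "det (idx_mat xs xs ?f) * b ^ ?p
      = b ^ ?m * det (((a + 2) * b) \<cdot>\<^sub>m 1\<^sub>m ?p + (2 * a) \<cdot>\<^sub>m (B * B\<^sup>T))"
    using det_incidence_block[OF B, of "a + 2" b] by simp
  also have "((a + 2) * b) \<cdot>\<^sub>m 1\<^sub>m ?p + (2 * a) \<cdot>\<^sub>m (B * B\<^sup>T)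
      = ((a + 2) * b + 2 * a * of_nat r) \<cdot>\<^sub>m 1\<^sub>m ?p + (2 * a) \<cdot>\<^sub>m ?A"
    unfolding BBT using A by (intro eq_matI) (auto simp: algebra_simps)
  finally show ?thesis
    by (simp add: det_affine[OF A] eigenvalue_mset_def algebra_simps)
qed

end

section \<open>The characteristic polynomial of the join\<close>

text \<open>
  The transmission of a vertex of the join of level \<open>l\<close> on the side with parameters \<open>p, r\<close>,
  the other side having parameters \<open>q, s\<close>.
\<close>
definition join_transmission :: "real \<Rightarrow> real \<Rightarrow> real \<Rightarrow> real \<Rightarrow> real \<Rightarrow> real" where
  "join_transmission p r q s l = (2 + l) * (p + p * r / 2) + p * r / 2 - 2 * (1 + l) * (1 + r)
     + (1 + l) * (q + q * s / 2) + q * s / 2"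

definition pair_mean :: "real \<Rightarrow> real \<Rightarrow> real \<Rightarrow> real \<Rightarrow> real \<Rightarrow> real" where
  "pair_mean p r q s l = - l + 5*p/2 + 3*q/2 + 7*p*r/4 + 5*q*s/4 - 4*r - 4"

definition pair_dev :: "real \<Rightarrow> real \<Rightarrow> real \<Rightarrow> real \<Rightarrow> real \<Rightarrow> real" where
  "pair_dev p r q s l = 1/2 * sqrt (Delta1 p r q s l)"

text \<open>The matrix \<open>[[z - t 0 + 2, 2 r], [4, z - t 1 + 4 r]]\<close> of one side has this determinant at \<open>l = r\<close>.\<close>
lemma quadratic_factors:
  fixes p r q s l :: real and z :: complex
  assumes l: "0 \<le> l + r"
  defines "t \<equiv> join_transmission p r q s"
    and "a \<equiv> pair_mean p r q s l" and "d \<equiv> pair_dev p r q s l"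
  shows "(z - of_real (t 0) + 2) * (z - of_real (t 1)) + 2 * (z - of_real (t 0)) * (of_real l + of_real r)
    = (z - of_real (a + d)) * (z - of_real (a - d))"
proof -
  \<comment> \<open>Completing the square leaves \<open>16 * (l + r)\<close>, so the radicand is
    nonnegative and \<open>d\<close> squares to a quarter of it.\<close>
  have D: "Delta1 p r q s l = (2 * l + 4 * r - p - q - p * r / 2 - q * s / 2)\<^sup>2 + 16 * (l + r)"
    by (simp add: Delta1_def power2_eq_square field_simps)
  then have "0 \<le> Delta1 p r q s l" using l by simp
  then have "d\<^sup>2 = Delta1 p r q s l / 4"
    by (simp add: d_def pair_dev_def power2_eq_square real_sqrt_mult_self)
  then have d: "d\<^sup>2 = (l + 2 * r - p/2 - q/2 - p * r / 4 - q * s / 4)\<^sup>2 + 4 * (l + r)"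
    unfolding D by (simp add: power2_eq_square field_simps)
  \<comment> \<open>The monic quadratic is determined by the sum and the product of its
    roots.\<close>
  have sum: "t 0 + t 1 = 2 * a + 2 * (l + r) + 2"
    by (simp add: t_def join_transmission_def a_def pair_mean_def field_simps)
  have prod: "(t 0 - 2) * t 1 - 2 * t 0 * (l + r) = a\<^sup>2 - d\<^sup>2"
    unfolding d by (simp add: t_def join_transmission_def a_def pair_mean_def power2_eq_square field_simps)
  have "(z - of_real (t 0) + 2) * (z - of_real (t 1)) + 2 * (z - of_real (t 0)) * (of_real l + of_real r)
      = z\<^sup>2 - z * of_real (t 0 + t 1 - 2 - 2 * (l + r)) + of_real ((t 0 - 2) * t 1 - 2 * t 0 * (l + r))"
    by (simp add: power2_eq_square algebra_simps)
  also have "\<dots> = z\<^sup>2 - z * of_real (2 * a) + of_real (a\<^sup>2 - d\<^sup>2)"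
    unfolding prod by (simp add: sum)
  also have "\<dots> = (z - of_real (a + d)) * (z - of_real (a - d))"
    by (simp add: power2_eq_square algebra_simps)
  finally show ?thesis .
qed

definition pair_factor :: "real \<Rightarrow> real \<Rightarrow> real \<Rightarrow> real \<Rightarrow> real \<Rightarrow> complex poly" where
  "pair_factor p r q s l = [:- of_real (pair_mean p r q s l + pair_dev p r q s l), 1:]
     * [:- of_real (pair_mean p r q s l - pair_dev p r q s l), 1:]"

definition pair_roots :: "real \<Rightarrow> real \<Rightarrow> real \<Rightarrow> real \<Rightarrow> real \<Rightarrow> complex multiset" where
  "pair_roots p r q s l = {# of_real (pair_mean p r q s l + pair_dev p r q s l),
     of_real (pair_mean p r q s l - pair_dev p r q s l) #}"

lemma poly_pair_factor:
  assumes "0 \<le> l + r"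
  shows "poly (pair_factor p r q s l) z
    = (z - of_real (join_transmission p r q s 0) + 2) * (z - of_real (join_transmission p r q s 1))
      + 2 * (z - of_real (join_transmission p r q s 0)) * (of_real l + of_real r)"
  unfolding quadratic_factors[OF assms] by (simp add: pair_factor_def algebra_simps)

lemma pair_factor_nonzero [simp]: "pair_factor p r q s l \<noteq> 0"
  by (simp add: pair_factor_def)

lemma proots_pair_factor: "proots (pair_factor p r q s l) = pair_roots p r q s l"
  by (simp add: pair_factor_def pair_roots_def proots_mult del: mult_pCons_left mult_pCons_right)

lemma prod_pair_factor_nonzero: "(\<Prod>l\<in>#L. pair_factor p r q s l) \<noteq> 0"
  by (induction L) simp_all

lemma proots_prod_pair_factor:
  "proots (\<Prod>l\<in>#L. pair_factor p r q s l) = (\<Sum>l\<in>#L. pair_roots p r q s l)"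
  by (induction L)
    (simp_all add: proots_mult[OF pair_factor_nonzero prod_pair_factor_nonzero] proots_pair_factor)

text \<open>Exchanging the two graphs exchanges the two radicands, so the statements about one side
  also serve the other.\<close>

lemma Delta2_eq: "Delta2 p1 r1 p2 r2 = Delta1 p2 r2 p1 r1"
  by (intro ext) (simp add: Delta1_def Delta2_def algebra_simps)

fun join_overlap :: "('a + 'a set) + ('b + 'b set) \<Rightarrow> ('a + 'a set) + ('b + 'b set) \<Rightarrow> nat" where
  "join_overlap (Inl x) (Inl y) = card (ends x \<inter> ends y)"
| "join_overlap (Inr x) (Inr y) = card (ends x \<inter> ends y)"
| "join_overlap _ _ = 0"

text \<open>The numbering is chosen so that \<open>i < 2\<close> recovers the side and
  \<open>i mod 2\<close> the level.\<close>

fun cell :: "('a + 'a set) + ('b + 'b set) \<Rightarrow> nat" where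
  "cell (Inl x) = level x"
| "cell (Inr x) = 2 + level x"

text \<open>The matrix \<open>S\<close>, the part of the distance that depends only on the cells;
  the true distance is smaller by twice the overlap.\<close>

definition cell_dist :: "nat \<Rightarrow> nat \<Rightarrow> real" where
  "cell_dist i j = (if i < 2 \<longleftrightarrow> j < 2 then 2 else 1) + of_nat (i mod 2) + of_nat (j mod 2)"

lemma level_less: "level x < 2"
  by (cases x) simp_all

lemma level_mod_two [simp]: "level x mod 2 = level x"
  by (cases x) simp_all

lemma cell_less: "cell x < 4"
  by (cases x) (simp_all add: level_def split: sum.split)

definition cell_transmission :: "nat \<Rightarrow> nat \<Rightarrow> nat \<Rightarrow> nat \<Rightarrow> nat \<Rightarrow> real" where
  "cell_transmission p1 r1 p2 r2 i = (if i < 2 then join_transmission p1 r1 p2 r2 (real i)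
     else join_transmission p2 r2 p1 r1 (real i - 2))"

text \<open>The matrix \<open>N\<close>, which is \<open>z 1 - Q\<close> with the cell distances
  added back. It is block diagonal since vertices of different sides have overlap 0.\<close>

definition overlap_mat :: "nat \<Rightarrow> nat \<Rightarrow> nat \<Rightarrow> nat \<Rightarrow> complex
    \<Rightarrow> ('a + 'a set) + ('b + 'b set) \<Rightarrow> ('a + 'a set) + ('b + 'b set) \<Rightarrow> complex" where
  "overlap_mat p1 r1 p2 r2 z x y
    = (z - of_real (cell_transmission p1 r1 p2 r2 (cell x))) * of_bool (x = y)
      + 2 * of_nat (join_overlap x y)"

text \<open>The quotient \<open>K\<close> of \<open>overlap_mat\<close>: a vertex in cell
  \<open>i\<close> has \<open>1 + i mod 2\<close> ends, and each end overlaps one original vertex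
  and \<open>r1\<close> or \<open>r2\<close> midpoints.\<close>

definition cell_mat :: "nat \<Rightarrow> nat \<Rightarrow> nat \<Rightarrow> nat \<Rightarrow> complex \<Rightarrow> nat \<Rightarrow> nat \<Rightarrow> complex" where
  "cell_mat p1 r1 p2 r2 z i j = (z - of_real (cell_transmission p1 r1 p2 r2 i)) * of_bool (i = j)
     + (if i < 2 \<longleftrightarrow> j < 2
        then 2 * of_nat ((1 + i mod 2) * (if even j then 1 else if j < 2 then r1 else r2)) else 0)"

context
  fixes G1 :: "'a pair_pre_digraph" and G2 :: "'b pair_pre_digraph"
    and p1 r1 p2 r2 :: nat and J
  assumes G1: "regular_graph G1 r1" "card (pverts G1) = p1" "p1 \<noteq> 0"
    and G2: "regular_graph G2 r2" "card (pverts G2) = p2" "p2 \<noteq> 0"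
  defines "J \<equiv> subdivision_vertex_join G1 G2"
begin

lemma real_card_uedges: "real (card (uedges G1)) = real p1 * real r1 / 2"
    "real (card (uedges G2)) = real p2 * real r2 / 2"
proof -
  have "2 * real (card (uedges G1)) = real p1 * real r1"
    using arg_cong[OF handshake[OF G1(1)], of real] G1(2) by simp
  then show "real (card (uedges G1)) = real p1 * real r1 / 2" by simp
  have "2 * real (card (uedges G2)) = real p2 * real r2"
    using arg_cong[OF handshake[OF G2(1)], of real] G2(2) by simp
  then show "real (card (uedges G2)) = real p2 * real r2 / 2" by simp
qed

lemma pverts_J: "pverts J = (pverts G1 <+> uedges G1) <+> (pverts G2 <+> uedges G2)"
  unfolding J_def by (rule pverts_subdivision_vertex_join)

lemma graph_dist_J:
  assumes "x \<in> pverts J" "y \<in> pverts J"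
  shows "graph_dist J x y = real (join_dist x y)"
proof -
  have "pverts G1 \<noteq> {}" "pverts G2 \<noteq> {}" using G1 G2 by auto
  then show ?thesis using assms unfolding J_def
    by (intro graph_dist_subdivision_vertex_join pair_graph_regular[OF G1(1)] pair_graph_regular[OF G2(1)])
qed

lemma finite_sides:
  "finite (pverts G1)" "finite (uedges G1)" "finite (pverts G2)" "finite (uedges G2)"
  by (rule finite_pverts_regular[OF G1(1)] finite_uedges[OF pair_graph_regular[OF G1(1)]]
      finite_pverts_regular[OF G2(1)] finite_uedges[OF pair_graph_regular[OF G2(1)]])+

text \<open>The own side contributes through \<open>sum_side_dist\<close>. The opposite side
  contributes through \<open>sum_level\<close>, since distances across depend only on the
  levels.\<close>

lemma transmission_J:
  assumes x: "x \<in> pverts J"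
  shows "transmission J x = cell_transmission p1 r1 p2 r2 (cell x)"
proof -
  have "transmission J x = (\<Sum>y\<in>pverts J. real (join_dist x y))"
    unfolding transmission_def using x by (intro sum.cong refl graph_dist_J)
  also have "\<dots> = (\<Sum>y\<in>pverts G1 <+> uedges G1. real (join_dist x (Inl y)))
      + (\<Sum>y\<in>pverts G2 <+> uedges G2. real (join_dist x (Inr y)))"
    unfolding pverts_J by (subst sum.Plus) (simp_all add: finite_sides o_def)
  also have "\<dots> = cell_transmission p1 r1 p2 r2 (cell x)"
  proof (cases x)
    case (Inl x')
    then have x': "x' \<in> pverts G1 <+> uedges G1" using x by (simp add: pverts_J)
    have "(\<Sum>y\<in>pverts G2 <+> uedges G2. real (1 + level x' + level y))
        = (1 + real (level x')) * (real (card (pverts G2)) + real (card (uedges G2))) + real (card (uedges G2))"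
      using sum_level[OF G2(1), of "1 + real (level x')"] by (simp add: add.assoc)
    then show ?thesis using level_less[of x']
      unfolding Inl join_dist.simps sum_side_dist[OF G1(1) x']
      by (simp del: of_nat_add add: cell_transmission_def join_transmission_def G1(2) G2(2) real_card_uedges algebra_simps)
  next
    case (Inr x')
    then have x': "x' \<in> pverts G2 <+> uedges G2" using x by (simp add: pverts_J)
    have "(\<Sum>y\<in>pverts G1 <+> uedges G1. real (1 + level x' + level y))
        = (1 + real (level x')) * (real (card (pverts G1)) + real (card (uedges G1))) + real (card (uedges G1))"
      using sum_level[OF G1(1), of "1 + real (level x')"] by (simp add: add.assoc)
    then show ?thesis
      unfolding Inr join_dist.simps sum_side_dist[OF G2(1) x']
      by (simp del: of_nat_add add: cell_transmission_def join_transmission_def G1(2) G2(2) real_card_uedges algebra_simps)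
  qed
  finally show ?thesis .
qed

lemma graph_dist_overlap:
  assumes x: "x \<in> pverts J" and y: "y \<in> pverts J"
  shows "graph_dist J x y = cell_dist (cell x) (cell y) - 2 * real (join_overlap x y)"
proof -
  have [simp]: "level u < 2" for u :: "'c + 'd" by (rule level_less)
  show ?thesis
    using x y unfolding graph_dist_J[OF x y]
    by (cases x; cases y)
      (simp_all add: pverts_J cell_dist_def real_side_dist[OF pair_graph_regular[OF G1(1)]]
        real_side_dist[OF pair_graph_regular[OF G2(1)]])
qed

lemma poly_char_poly_J:
  assumes ws: "distinct ws" "set ws = pverts J"
  shows "poly (char_poly (map_mat complex_of_real (distance_signless_laplacian J ws))) z
    = det (idx_mat ws ws (\<lambda>x y. overlap_mat p1 r1 p2 r2 z x y - of_real (cell_dist (cell x) (cell y))))"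
proof -
  let ?Q = "map_mat complex_of_real (distance_signless_laplacian J ws)"
  have Q: "?Q \<in> carrier_mat (length ws) (length ws)"
    by (simp add: distance_signless_laplacian_def transmission_matrix_def distance_matrix_def mat_diag_def)
  have mem: "ws ! i \<in> pverts J" if "i < length ws" for i
    using that ws(2) nth_mem by blast
  have "- char_matrix ?Q z = idx_mat ws ws (\<lambda>x y. overlap_mat p1 r1 p2 r2 z x y - of_real (cell_dist (cell x) (cell y)))"
  proof (rule eq_matI)
    fix i j
    assume "i < dim_row (idx_mat ws ws (\<lambda>x y. overlap_mat p1 r1 p2 r2 z x y - complex_of_real (cell_dist (cell x) (cell y))))"
      "j < dim_col (idx_mat ws ws (\<lambda>x y. overlap_mat p1 r1 p2 r2 z x y - complex_of_real (cell_dist (cell x) (cell y))))"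
    then have ij: "i < length ws" "j < length ws" by simp_all
    then show "(- char_matrix ?Q z) $$ (i, j)
      = idx_mat ws ws (\<lambda>x y. overlap_mat p1 r1 p2 r2 z x y - of_real (cell_dist (cell x) (cell y))) $$ (i, j)"
      using ws(1) Q
      by (simp add: char_matrix_def distance_signless_laplacian_def transmission_matrix_def
          distance_matrix_def mat_diag_def overlap_mat_def graph_dist_overlap mem transmission_J
          nth_eq_iff_index_eq)
  qed (use Q in \<open>simp_all add: char_matrix_def\<close>)
  then show ?thesis by (simp add: char_poly_matrix[OF Q])
qed

text \<open>The diagonal term is seen only in the cell of \<open>x\<close>; the overlap term is
  evaluated by the overlap sums of regular graphs.\<close>

lemma overlap_mat_equitable:
  assumes x: "x \<in> pverts J" and j: "j < 4"
  shows "(\<Sum>y | y \<in> pverts J \<and> cell y = j. overlap_mat p1 r1 p2 r2 z x y) = cell_mat p1 r1 p2 r2 z (cell x) j"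
proof -
  have fin: "finite {y \<in> pverts J. cell y = j}"
    using finite_sides by (simp add: pverts_J)
  have "(\<Sum>y | y \<in> pverts J \<and> cell y = j. (z - of_real (cell_transmission p1 r1 p2 r2 (cell x))) * of_bool (x = y))
      = (z - of_real (cell_transmission p1 r1 p2 r2 (cell x))) * of_bool (cell x = j)"
  proof (cases "cell x = j")
    case True
    then have "{y \<in> pverts J. cell y = j} \<inter> {y. x = y} = {x}" using x by auto
    then show ?thesis using True fin by simp
  next
    case False
    then show ?thesis by (auto intro!: sum.neutral)
  qed
  moreover have "(\<Sum>y | y \<in> pverts J \<and> cell y = j. join_overlap x y)
      = (if cell x < 2 \<longleftrightarrow> j < 2 then (1 + cell x mod 2) * (if even j then 1 else if j < 2 then r1 else r2) else 0)"
  proof -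
    have j': "j = 0 \<or> j = 1 \<or> j = 2 \<or> j = 3" using j by auto
    have cells: "{y \<in> pverts J. cell y = 0} = Inl ` Inl ` pverts G1"
      "{y \<in> pverts J. cell y = 1} = Inl ` Inr ` uedges G1"
      "{y \<in> pverts J. cell y = 2} = Inr ` Inl ` pverts G2"
      "{y \<in> pverts J. cell y = 3} = Inr ` Inr ` uedges G2"
      by (auto simp: pverts_J)
    have sums: "(\<Sum>y\<in>Inl ` A. f y) = (\<Sum>y\<in>A. f (Inl y))" "(\<Sum>y\<in>Inr ` B. g y) = (\<Sum>y\<in>B. g (Inr y))"
      for A :: "'c set" and B :: "'d set" and f :: "'c + 'e \<Rightarrow> nat" and g :: "'f + 'd \<Rightarrow> nat"
      by (simp_all add: sum.reindex)
    show ?thesis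
    proof (cases x)
      case (Inl x')
      then have x': "x' \<in> pverts G1 <+> uedges G1" using x by (simp add: pverts_J)
      show ?thesis
        using j' unfolding Inl
        by (elim disjE; simp only: cells sums join_overlap.simps ends_simps cell.simps
            sum_pverts_overlap[OF G1(1) x'] sum_uedges_overlap[OF G1(1) x'])
          (simp_all add: level_less mult.commute)
    next
      case (Inr x')
      then have x': "x' \<in> pverts G2 <+> uedges G2" using x by (simp add: pverts_J)
      show ?thesis
        using j' unfolding Inr
        by (elim disjE; simp only: cells sums join_overlap.simps ends_simps cell.simps
            sum_pverts_overlap[OF G2(1) x'] sum_uedges_overlap[OF G2(1) x'])
          (simp_all add: level_less mult.commute)
    qed
  qed
  ultimately show ?thesis
    by (simp add: overlap_mat_def cell_mat_def sum.distrib flip: sum_distrib_left of_nat_sum)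
qed

lemma card_cell:
  assumes "j < 4"
  shows "real (card {y \<in> pverts J. cell y = j})
    = [real p1, real p1 * real r1 / 2, real p2, real p2 * real r2 / 2] ! j"
proof -
  have cells: "{y \<in> pverts J. cell y = 0} = Inl ` Inl ` pverts G1"
    "{y \<in> pverts J. cell y = 1} = Inl ` Inr ` uedges G1"
    "{y \<in> pverts J. cell y = 2} = Inr ` Inl ` pverts G2"
    "{y \<in> pverts J. cell y = 3} = Inr ` Inr ` uedges G2"
    by (auto simp: pverts_J)
  have "j = 0 \<or> j = 1 \<or> j = 2 \<or> j = 3" using assms by auto
  then show ?thesis
    by (elim disjE; simp only: cells) (simp_all add: card_image G1(2) G2(2) real_card_uedges)
qed

text \<open>The stated matrix is the quotient of \<open>Q\<close> by the four cells. The identity is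
  checked entry by entry once the cell sizes are inserted.\<close>

lemma poly_char_poly_quotient_matrix:
  "poly (char_poly (map_mat complex_of_real (quotient_matrix p1 r1 p2 r2))) z
    = det (idx_mat [0..<4] [0..<4]
        (\<lambda>i j. cell_mat p1 r1 p2 r2 z i j - of_real (cell_dist i j) * of_nat (card {y \<in> pverts J. cell y = j})))"
proof -
  let ?Q = "quotient_matrix p1 r1 p2 r2"
  let ?n = "\<lambda>j. [real p1, real p1 * real r1 / 2, real p2, real p2 * real r2 / 2] ! j"
  have dims: "dim_row ?Q = 4" "dim_col ?Q = 4"
    by (simp_all add: quotient_matrix_def mat_of_rows_list_def)
  then have Q: "map_mat complex_of_real ?Q \<in> carrier_mat 4 4"
    by (intro carrier_matI) simp_all
  have entry: "z * of_bool (i = j) - of_real (?Q $$ (i, j)) = cell_mat p1 r1 p2 r2 z i j - of_real (cell_dist i j * ?n j)"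
    if "i < 4" "j < 4" for i j
  proof -
    have [simp]: "Suc (Suc (Suc 0)) mod Suc (Suc 0) = Suc 0" "\<not> Suc (Suc 0) dvd Suc (Suc (Suc 0))"
      by (simp_all add: mod_Suc dvd_eq_mod_eq_0)
    have "i = 0 \<or> i = 1 \<or> i = 2 \<or> i = 3" "j = 0 \<or> j = 1 \<or> j = 2 \<or> j = 3" using that by auto
    then show ?thesis
      by (elim disjE)
        (simp_all add: quotient_matrix_def mat_of_rows_list_def cell_dist_def
          cell_mat_def cell_transmission_def join_transmission_def numeral_2_eq_2 numeral_3_eq_3 field_simps)
  qed
  have "- char_matrix (map_mat complex_of_real ?Q) z = idx_mat [0..<4] [0..<4]
        (\<lambda>i j. cell_mat p1 r1 p2 r2 z i j - of_real (cell_dist i j * real (card {y \<in> pverts J. cell y = j})))"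
    by (rule eq_matI)
      (auto simp: char_matrix_def dims card_cell simp flip: entry simp del: of_real_mult)
  then show ?thesis by (simp add: char_poly_matrix[OF Q])
qed

end

section \<open>From polynomial identities to multisets of eigenvalues\<close>

lemma proots_linear_power: "proots ([:- c, 1:] ^ n) = replicate_mset n (c :: 'a :: idom)"
  by (induction n) (simp_all add: proots_mult del: mult_pCons_left)

lemma image_mset_sum: "finite A \<Longrightarrow> image_mset f (\<Sum>j\<in>A. g j) = (\<Sum>j\<in>A. image_mset f (g j))"
  by (induction A rule: finite_induct) simp_all

text \<open>\<open>K\<close> has one two by two block per side, whose determinant is the quadratic
  factor at \<open>l = r\<close>. The eigenvalue \<open>r\<close> of each regular graph contributes
  the same factor, so that these cancel in the end.\<close>

lemma det_cell_mat:
  "det (idx_mat [0..<4] [0..<4] (cell_mat p1 r1 p2 r2 z))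
    = poly (pair_factor p1 r1 p2 r2 r1) z * poly (pair_factor p2 r2 p1 r1 r2) z"
proof -
  let ?K = "cell_mat p1 r1 p2 r2 z"
  have upt: "[0..<4] = [0, 1] @ [2, 3]"
    by (simp add: upt_rec)
  have "det (idx_mat [0..<4] [0..<4] ?K) = (?K 0 0 * ?K 1 1 - ?K 0 1 * ?K 1 0) * (?K 2 2 * ?K 3 3 - ?K 2 3 * ?K 3 2)"
    unfolding upt by (subst det_idx_mat_block_diag) (auto simp: det_idx_mat_two cell_mat_def)
  also have "?K 0 0 * ?K 1 1 - ?K 0 1 * ?K 1 0 = poly (pair_factor p1 r1 p2 r2 r1) z"
    by (simp add: poly_pair_factor cell_mat_def cell_transmission_def algebra_simps)
  also have "?K 2 2 * ?K 3 3 - ?K 2 3 * ?K 3 2 = poly (pair_factor p2 r2 p1 r1 r2) z"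
    by (simp add: poly_pair_factor cell_mat_def cell_transmission_def algebra_simps)
  finally show ?thesis .
qed

text \<open>By \<open>adjacency_eigenvalue_ge\<close>, every quadratic factor splits into linear
  factors with real roots.\<close>

lemma prod_eigenvalues_pair_factor:
  fixes p q s :: real and r :: nat
  assumes G: "regular_graph G r" and vs: "distinct vs" "set vs = pverts G"
    and L: "eigenvalue_mset (adjacency_matrix G vs) = image_mset complex_of_real L"
  defines "t \<equiv> join_transmission p (real r) q s"
  shows "(\<Prod>l\<in>#eigenvalue_mset (adjacency_matrix G vs).
      (z - of_real (t 0) + 2) * (z - of_real (t 1)) + 2 * (z - of_real (t 0)) * (l + of_nat r))
    = poly (\<Prod>l\<in>#L. pair_factor p r q s l) z"
proof -
  have "0 \<le> l + real r" if "l \<in># L" for l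
    using adjacency_eigenvalue_ge[OF G vs] L that by simp
  then show ?thesis
    unfolding L poly_prod_mset image_mset.compositionality o_def t_def
    by (intro arg_cong[of _ _ prod_mset] image_mset_cong) (simp add: poly_pair_factor)
qed

context
  fixes G1 :: "'a pair_pre_digraph" and G2 :: "'b pair_pre_digraph"
    and p1 r1 p2 r2 :: nat and J ws vs1 vs2 and L1 L2 :: "real multiset"
  assumes G1: "regular_graph G1 r1" "card (pverts G1) = p1" "p1 \<noteq> 0"
    and G2: "regular_graph G2 r2" "card (pverts G2) = p2" "p2 \<noteq> 0"
    and vs1: "distinct vs1" "set vs1 = pverts G1" and vs2: "distinct vs2" "set vs2 = pverts G2"
    and L1: "eigenvalue_mset (adjacency_matrix G1 vs1) = image_mset complex_of_real L1"
    and L2: "eigenvalue_mset (adjacency_matrix G2 vs2) = image_mset complex_of_real L2"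
  defines "J \<equiv> subdivision_vertex_join G1 G2"
  assumes ws: "distinct ws" "set ws = pverts J"
begin

text \<open>Reordering \<open>ws\<close> by sides makes the matrix block diagonal, and
  \<open>det_side\<close> evaluates each block. The midpoint transmissions \<open>c1\<close> and
  \<open>c2\<close> enter as its parameter \<open>b\<close>, which is \<open>z - c1\<close> or
  \<open>z - c2\<close>.\<close>

lemma det_overlap_mat:
  defines "c1 \<equiv> complex_of_real (join_transmission p1 r1 p2 r2 1)"
    and "c2 \<equiv> complex_of_real (join_transmission p2 r2 p1 r1 1)"
  shows "det (idx_mat ws ws (overlap_mat p1 r1 p2 r2 z)) * (z - c1) ^ p1 * (z - c2) ^ p2
    = (z - c1) ^ (p1 * r1 div 2) * (z - c2) ^ (p2 * r2 div 2)
      * poly (\<Prod>l\<in>#L1. pair_factor p1 r1 p2 r2 l) z * poly (\<Prod>l\<in>#L2. pair_factor p2 r2 p1 r1 l) z"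
proof -
  obtain es1 es2 where es1: "distinct es1" "set es1 = uedges G1" and es2: "distinct es2" "set es2 = uedges G2"
    by (metis finite_distinct_list finite_uedges pair_graph_regular[OF G1(1)] pair_graph_regular[OF G2(1)])
  define N :: "('a + 'a set) + ('b + 'b set) \<Rightarrow> _" where "N = overlap_mat p1 r1 p2 r2 z"
  let ?f = "\<lambda>a b x y. (if level x = 0 then a else b) * of_bool (x = y) + 2 * of_nat (card (ends x \<inter> ends y))"
  let ?t1 = "join_transmission p1 r1 p2 r2" and ?t2 = "join_transmission p2 r2 p1 r1"
  define xs1 where "xs1 = map Inl vs1 @ map Inr es1"
  define xs2 where "xs2 = map Inl vs2 @ map Inr es2"
  have xs: "distinct (map Inl xs1 @ map Inr xs2)" "set (map Inl xs1 @ map Inr xs2) = pverts J"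
    using vs1 vs2 es1 es2
    by (auto simp: xs1_def xs2_def distinct_map inj_on_def J_def pverts_subdivision_vertex_join)
  \<comment> \<open>By \<open>handshake\<close>, the division in \<open>p1 * r1 div 2\<close> and
    \<open>p2 * r2 div 2\<close> is exact.\<close>
  have len: "length vs1 = p1" "length es1 = p1 * r1 div 2" "length vs2 = p2" "length es2 = p2 * r2 div 2"
    using distinct_card[OF vs1(1)] distinct_card[OF es1(1)] distinct_card[OF vs2(1)] distinct_card[OF es2(1)]
      vs1 es1 vs2 es2 G1(2) G2(2) handshake[OF G1(1)] handshake[OF G2(1)] by auto
  have "det (idx_mat ws ws N) = det (idx_mat (map Inl xs1 @ map Inr xs2) (map Inl xs1 @ map Inr xs2) N)"
    using ws xs by (intro det_idx_mat_reorder) simp_all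
  also have "\<dots> = det (idx_mat (map Inl xs1) (map Inl xs1) N) * det (idx_mat (map Inr xs2) (map Inr xs2) N)"
    by (rule det_idx_mat_block_diag) (auto simp: N_def overlap_mat_def)
  also have "idx_mat (map Inl xs1) (map Inl xs1) N = idx_mat xs1 xs1 (?f (z - of_real (?t1 0)) (z - of_real (?t1 1)))"
    unfolding idx_mat_map
    by (rule idx_mat_cong) (auto simp: N_def overlap_mat_def cell_transmission_def level_def split: sum.split)
  also have "idx_mat (map Inr xs2) (map Inr xs2) N = idx_mat xs2 xs2 (?f (z - of_real (?t2 0)) (z - of_real (?t2 1)))"
    unfolding idx_mat_map
    by (rule idx_mat_cong) (auto simp: N_def overlap_mat_def cell_transmission_def level_def split: sum.split)
  finally have det: "det (idx_mat ws ws N)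
    = det (idx_mat xs1 xs1 (?f (z - of_real (?t1 0)) (z - of_real (?t1 1))))
      * det (idx_mat xs2 xs2 (?f (z - of_real (?t2 0)) (z - of_real (?t2 1))))" .
  note side1 = det_side[OF G1(1) vs1 es1, of "z - of_real (?t1 0)" "z - of_real (?t1 1)", folded xs1_def,
      unfolded prod_eigenvalues_pair_factor[OF G1(1) vs1 L1] len]
  note side2 = det_side[OF G2(1) vs2 es2, of "z - of_real (?t2 0)" "z - of_real (?t2 1)", folded xs2_def,
      unfolded prod_eigenvalues_pair_factor[OF G2(1) vs2 L2] len]
  show ?thesis
    unfolding N_def[symmetric] det c1_def c2_def
    using arg_cong2[OF side1 side2, of "(*)"] by (simp only: mult_ac)
qed

text \<open>Two products of polynomials agree at every complex \<open>z\<close>, by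
  \<open>det_equitable\<close> with \<open>cell_dist\<close> as \<open>S\<close>, so their root
  multisets agree. Nothing is divided out here, which keeps all multiplicities natural
  numbers.\<close>

lemma eigenvalue_mset_join:
  defines "c1 \<equiv> complex_of_real (join_transmission p1 r1 p2 r2 1)"
    and "c2 \<equiv> complex_of_real (join_transmission p2 r2 p1 r1 1)"
  shows "eigenvalue_mset (distance_signless_laplacian J ws)
      + pair_roots p1 r1 p2 r2 r1 + pair_roots p2 r2 p1 r1 r2
      + replicate_mset p1 c1 + replicate_mset p2 c2
    = replicate_mset (p1 * r1 div 2) c1 + replicate_mset (p2 * r2 div 2) c2
      + (\<Sum>l\<in>#L1. pair_roots p1 r1 p2 r2 l) + (\<Sum>l\<in>#L2. pair_roots p2 r2 p1 r1 l)
      + eigenvalue_mset (quotient_matrix p1 r1 p2 r2)"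
proof -
  let ?q1 = "pair_factor p1 r1 p2 r2" and ?q2 = "pair_factor p2 r2 p1 r1"
  let ?P1 = "\<Prod>l\<in>#L1. ?q1 l" and ?P2 = "\<Prod>l\<in>#L2. ?q2 l"
  let ?Q = "map_mat complex_of_real (distance_signless_laplacian J ws)"
  let ?K = "map_mat complex_of_real (quotient_matrix p1 r1 p2 r2)"
  let ?m1 = "p1 * r1 div 2" and ?m2 = "p2 * r2 div 2"
  have carrier: "?Q \<in> carrier_mat (length ws) (length ws)" "?K \<in> carrier_mat 4 4"
    by (simp add: distance_signless_laplacian_def transmission_matrix_def distance_matrix_def mat_diag_def)
      (intro carrier_matI; simp add: quotient_matrix_def mat_of_rows_list_def)
  have nz: "char_poly ?Q \<noteq> 0" "char_poly ?K \<noteq> 0"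
    using degree_monic_char_poly[OF carrier(1)] degree_monic_char_poly[OF carrier(2)] by auto
  have "char_poly ?Q * ?q1 r1 * ?q2 r2 * [:- c1, 1:] ^ p1 * [:- c2, 1:] ^ p2
    = [:- c1, 1:] ^ ?m1 * [:- c2, 1:] ^ ?m2 * ?P1 * ?P2 * char_poly ?K" (is "?L = ?R")
  proof (rule poly_ext)
    fix z
    have "poly (char_poly ?Q) z * (poly (?q1 r1) z * poly (?q2 r2) z)
        = det (idx_mat ws ws (\<lambda>x y. overlap_mat p1 r1 p2 r2 z x y - of_real (cell_dist (cell x) (cell y))))
          * det (idx_mat [0..<4] [0..<4] (cell_mat p1 r1 p2 r2 z))"
      by (simp only: det_cell_mat poly_char_poly_J[OF G1 G2 ws[unfolded J_def], folded J_def])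
    also have "\<dots> = det (idx_mat ws ws (overlap_mat p1 r1 p2 r2 z))
          * det (idx_mat [0..<4] [0..<4] (\<lambda>i j. cell_mat p1 r1 p2 r2 z i j
              - of_real (cell_dist i j) * of_nat (card {y \<in> set ws. cell y = j})))"
      using overlap_mat_equitable[OF G1 G2, folded J_def, folded ws(2)]
      by (intro det_equitable[where S = "\<lambda>i j. of_real (cell_dist i j)"] ws(1) cell_less)
    also have "\<dots> = det (idx_mat ws ws (overlap_mat p1 r1 p2 r2 z)) * poly (char_poly ?K) z"
      by (simp only: poly_char_poly_quotient_matrix[OF G1 G2, folded J_def] ws(2))
    finally have "poly (char_poly ?Q) z * (poly (?q1 r1) z * poly (?q2 r2) z) * (z - c1) ^ p1 * (z - c2) ^ p2
        = (det (idx_mat ws ws (overlap_mat p1 r1 p2 r2 z)) * (z - c1) ^ p1 * (z - c2) ^ p2) * poly (char_poly ?K) z"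
      by (simp only: mult_ac)
    then show "poly ?L z = poly ?R z"
      unfolding c1_def c2_def det_overlap_mat by (simp add: mult_ac del: mult_pCons_left mult_pCons_right)
  qed
  then have "proots ?L = proots ?R" by (rule arg_cong)
  then show ?thesis
    by (simp add: proots_mult nz prod_pair_factor_nonzero proots_prod_pair_factor proots_linear_power
        proots_pair_factor eigenvalue_mset_def del: mult_pCons_left mult_pCons_right prod_mset_zero_iff)
qed

end

text \<open>Isolates the common part \<open>min m n\<close>, whose cancellation leaves the truncated
  multiplicities.\<close>

lemma replicate_mset_diff:
  "replicate_mset m c = replicate_mset (m - n) c + replicate_mset (min m n) c"
  by (rule multiset_eqI) auto

theorem theorem3p22:
  fixes G1 :: "'a pair_pre_digraph" and G2 :: "'b pair_pre_digraph"
    and p1 r1 p2 r2 :: nat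
    and ev1 ev2 :: "nat \<Rightarrow> real"
    and vs1 :: "'a list" and vs2 :: "'b list"
    and ws :: "(('a + 'a set) + ('b + 'b set)) list"
  assumes "regular_graph G1 r1" and "card (pverts G1) = p1"
    and "regular_graph G2 r2" and "card (pverts G2) = p2"
    and "distinct vs1" and "set vs1 = pverts G1"
    and "distinct vs2" and "set vs2 = pverts G2"
    and "distinct ws" and "set ws = pverts (subdivision_vertex_join G1 G2)"
    and "eigenvalue_mset (adjacency_matrix G1 vs1)
           = image_mset complex_of_real ({# real r1 #} + image_mset ev1 (mset_set {2..p1}))"
    and "eigenvalue_mset (adjacency_matrix G2 vs2)
           = image_mset complex_of_real ({# real r2 #} + image_mset ev2 (mset_set {2..p2}))"
  shows
    "let P1 = real p1; R1 = real r1; P2 = real p2; R2 = real r2;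
         a1 = (\<lambda>l. - l + 5*P1/2 + 3*P2/2 + 7*P1*R1/4 + 5*P2*R2/4 - 4*R1 - 4);
         a2 = (\<lambda>l. - l + 3*P1/2 + 5*P2/2 + 5*P1*R1/4 + 7*P2*R2/4 - 4*R2 - 4);
         d1 = (\<lambda>l. 1/2 * sqrt (Delta1 P1 R1 P2 R2 l));
         d2 = (\<lambda>l. 1/2 * sqrt (Delta2 P1 R1 P2 R2 l));
         c1 = 3*P1 + 2*P1*R1 + 2*P2 + 3/2*P2*R2 - 4*R1 - 4;
         c2 = 2*P1 + 3/2*P1*R1 + 3*P2 + 2*P2*R2 - 4*R2 - 4
     in eigenvalue_mset (distance_signless_laplacian (subdivision_vertex_join G1 G2) ws)
          + image_mset complex_of_real
              (replicate_mset (p1 - p1 * r1 div 2) c1 + replicate_mset (p2 - p2 * r2 div 2) c2)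
        = image_mset complex_of_real
              ((\<Sum>j\<in>{2..p1}. {# a1 (ev1 j) + d1 (ev1 j), a1 (ev1 j) - d1 (ev1 j) #})
             + (\<Sum>j\<in>{2..p2}. {# a2 (ev2 j) + d2 (ev2 j), a2 (ev2 j) - d2 (ev2 j) #})
             + replicate_mset (p1 * r1 div 2 - p1) c1
             + replicate_mset (p2 * r2 div 2 - p2) c2)
          + eigenvalue_mset (quotient_matrix P1 R1 P2 R2)"
proof -
  \<comment> \<open>The assumed spectra contain \<open>r1\<close> and \<open>r2\<close>, whereas a
    graph without vertices has characteristic polynomial 1 and an empty spectrum.\<close>
  have nonempty: "card (pverts G) \<noteq> 0"
    if "distinct vs" "set vs = pverts G" "eigenvalue_mset (adjacency_matrix G vs) \<noteq> {#}"
    for G :: "'c pair_pre_digraph" and vs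
  proof
    assume "card (pverts G) = 0"
    then have "vs = []" using that(1,2) distinct_card[of vs] by simp
    then have "adjacency_matrix G vs \<in> carrier_mat 0 0" by (simp add: adjacency_matrix_def)
    then have "char_poly (map_mat complex_of_real (adjacency_matrix G vs)) = 1"
      unfolding char_poly_def by (intro det_dim_zero char_poly_matrix_closed) simp
    then show False using that(3) by (simp add: eigenvalue_mset_def)
  qed
  have p: "p1 \<noteq> 0" "p2 \<noteq> 0"
    using nonempty[OF assms(5,6)] nonempty[OF assms(7,8)] assms(2,4,11,12) by auto
  define c1 where "c1 = 3*real p1 + 2*real p1*real r1 + 2*real p2 + 3/2*real p2*real r2 - 4*real r1 - 4"
  define c2 where "c2 = 2*real p1 + 3/2*real p1*real r1 + 3*real p2 + 2*real p2*real r2 - 4*real r2 - 4"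
  \<comment> \<open>The eigenvalues listed with explicit multiplicity are the transmissions of the
    edge midpoints.\<close>
  have c: "join_transmission p1 r1 p2 r2 1 = c1" "join_transmission p2 r2 p1 r1 1 = c2"
    by (simp_all add: c1_def c2_def join_transmission_def field_simps)
  let ?m1 = "p1 * r1 div 2" and ?m2 = "p2 * r2 div 2"
  let ?a1 = "\<lambda>l. - l + 5*real p1/2 + 3*real p2/2 + 7*real p1*real r1/4 + 5*real p2*real r2/4 - 4*real r1 - 4"
  let ?a2 = "\<lambda>l. - l + 3*real p1/2 + 5*real p2/2 + 5*real p1*real r1/4 + 7*real p2*real r2/4 - 4*real r2 - 4"
  let ?d1 = "\<lambda>l. 1/2 * sqrt (Delta1 p1 r1 p2 r2 l)" and ?d2 = "\<lambda>l. 1/2 * sqrt (Delta2 p1 r1 p2 r2 l)"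
  have roots: "pair_roots p1 r1 p2 r2 l = image_mset complex_of_real {# ?a1 l + ?d1 l, ?a1 l - ?d1 l #}"
    "pair_roots p2 r2 p1 r1 l = image_mset complex_of_real {# ?a2 l + ?d2 l, ?a2 l - ?d2 l #}" for l
    by (simp_all add: pair_roots_def pair_mean_def pair_dev_def Delta2_eq algebra_simps)
  let ?S = "eigenvalue_mset (distance_signless_laplacian (subdivision_vertex_join G1 G2) ws)"
  let ?T = "eigenvalue_mset (quotient_matrix p1 r1 p2 r2)"
  let ?X1 = "\<Sum>j\<in>{2..p1}. pair_roots p1 r1 p2 r2 (ev1 j)" and ?X2 = "\<Sum>j\<in>{2..p2}. pair_roots p2 r2 p1 r1 (ev2 j)"
  let ?rep = "\<lambda>n c. replicate_mset n (complex_of_real c)"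
  \<comment> \<open>The eigenvalues \<open>r1\<close> and \<open>r2\<close> are split off from the
    adjacency spectra; their pairs occur on both sides and will cancel.\<close>
  have "?S + pair_roots p1 r1 p2 r2 r1 + pair_roots p2 r2 p1 r1 r2 + ?rep p1 c1 + ?rep p2 c2
      = ?rep ?m1 c1 + ?rep ?m2 c2 + (pair_roots p1 r1 p2 r2 r1 + ?X1) + (pair_roots p2 r2 p1 r1 r2 + ?X2) + ?T"
    using eigenvalue_mset_join[OF assms(1,2) p(1) assms(3,4) p(2) assms(5-8,11,12,9,10), unfolded c]
    by (simp add: sum_unfold_sum_mset image_mset.compositionality o_def)
  moreover have "?rep p1 c1 = ?rep (p1 - ?m1) c1 + ?rep (min p1 ?m1) c1"
    "?rep ?m1 c1 = ?rep (?m1 - p1) c1 + ?rep (min p1 ?m1) c1"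
    "?rep p2 c2 = ?rep (p2 - ?m2) c2 + ?rep (min p2 ?m2) c2"
    "?rep ?m2 c2 = ?rep (?m2 - p2) c2 + ?rep (min p2 ?m2) c2"
    by (metis replicate_mset_diff min.commute)+
  ultimately have "?S + (?rep (p1 - ?m1) c1 + ?rep (p2 - ?m2) c2)
      = ?X1 + ?X2 + ?rep (?m1 - p1) c1 + ?rep (?m2 - p2) c2 + ?T"
    by (simp add: multiset_eq_iff)
  then show ?thesis
    unfolding Let_def c1_def[symmetric] c2_def[symmetric] roots
    by (simp add: image_mset_sum del: image_mset_add_mset)
qed

end
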